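(* There exists a function $g:\mathbb{N}\to\mathbb{R}$ with $g(k)/k\to 0$ as $k\to\infty$ such that for all integers $k\geq 2$, \[ r(k) \leq 2^{\left(2-\frac{3}{200}\right)k + g(k)}. \]
   Context: For an integer $k\ge 2$, the Ramsey number $r(k)$ is the least integer $N$ such that every two-coloring of the edges of the complete graph $K_N$ contains a monochromatic $K_k$ (a copy of $K_k$ all of whose edges have the same color). *)

theory Defs
  imports Complex_Main "HOL-Library.Ramsey"
begin

(* partn {..<N} k 2 {..<2} says: for every colouring f of the 2-element subsets of {..<N}
   (the edges of K_N) with colours 0 and 1, there are a colour i and a k-element set
   H of vertices all of whose edges have colour i. *)
definition ramsey_number :: "nat \<Rightarrow> nat" where
  "ramsey_number k = (LEAST N. partn {..<N} k 2 {..<2::nat})"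

(* The minimum is attained (so the LEAST above is genuine), and the property persists upwards. *)
lemma partn_iff_ramsey_number_le:
  "partn {..<N} k 2 {..<2::nat} \<longleftrightarrow> ramsey_number k \<le> N"
proof
  assume "partn {..<N} k 2 {..<2::nat}"
  then show "ramsey_number k \<le> N"
    unfolding ramsey_number_def by (rule Least_le)
next
  assume le: "ramsey_number k \<le> N"
  have "partn {..<ES 2 k k} k 2 {..<2::nat}"
    using ramsey2_full [of 2 k k] by (simp only: partn_lst_eq_partn)
  then have "partn {..<ramsey_number k} k 2 {..<2::nat}"
    unfolding ramsey_number_def by (rule LeastI)
  then have "partn_lst {..<ramsey_number k} [k, k] 2"
    by (simp only: partn_lst_eq_partn)
  then have "partn_lst {..<N} [k, k] 2"
    using le by (rule partn_lst_greater_resource)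
  then show "partn {..<N} k 2 {..<2::nat}"
    by (simp only: partn_lst_eq_partn)
qed

end

theory Submission
  imports Defs "HOL-Analysis.Convex"
begin

text \<open>The proof follows the approach of Gupta, Ndiaye, Norin and Wei to the theorem of Campos,
  Griffiths, Morris and Sahasrabudhe. Take vertex sets X, Y whose red density exceeds p by e > 0,
  and consider the potential e (|X| |Y|)^h for a small h > 0. By convexity, X has on average at
  least the same density to the red neighbourhood in Y of a vertex v of X. Hence, for some v,
  either moving to the red neighbourhood of v in both sets costs at most a factor x^h of the
  potential (v extends a red clique), or moving to the blue neighbourhood of v in X and the red one
  in Y costs at most a factor M^h (v extends a blue clique, and e grows), provided that v has
  blue degree at most M |X| and that x < (1 - M) p^(1/(1 - M)). If too many vertices of X have larger
  blue degree, they contain a blue clique, and a large blue book lets one move to a subset of X at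
  cost M^h per vertex with Y unchanged. When no further step is possible, Y is so large that
  a known bound on off-diagonal Ramsey numbers applies inside Y.

  In this way an exponential bound r(k,l) = O(x^(-k) y^(-l)) yields
  r(k,l) = O((sqrt x)^(-k) (sqrt (M y))^(-l)). Starting with the bounds of Erdos and Szekeres, where
  x + y = 1, three such improvements, mixed with known bounds by means of geometric means, reach
  the diagonal exponent.\<close>

section \<open>Graphs and exponential bounds on Ramsey numbers\<close>

text \<open>With \<open>R\<close> as red this is blue. Excluding \<open>x = y\<close> keeps it
  loopless, so that both colours satisfy \<open>graph\<close> and every lemma about one colour
  applies to the other.\<close>

definition co :: "('a \<Rightarrow> 'a \<Rightarrow> bool) \<Rightarrow> 'a \<Rightarrow> 'a \<Rightarrow> bool" where
  "co R x y \<longleftrightarrow> x \<noteq> y \<and> \<not> R x y"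

definition graph :: "('a \<Rightarrow> 'a \<Rightarrow> bool) \<Rightarrow> bool" where
  "graph R \<longleftrightarrow> symp R \<and> irreflp R"

definition has_clique :: "('a \<Rightarrow> 'a \<Rightarrow> bool) \<Rightarrow> 'a set \<Rightarrow> nat \<Rightarrow> bool" where
  "has_clique R V k \<longleftrightarrow>
    (\<exists>K\<subseteq>V. finite K \<and> card K = k \<and> (\<forall>x\<in>K. \<forall>y\<in>K. x \<noteq> y \<longrightarrow> R x y))"

definition nbs :: "('a \<Rightarrow> 'a \<Rightarrow> bool) \<Rightarrow> 'a \<Rightarrow> 'a set \<Rightarrow> 'a set" where
  "nbs R v A = {u \<in> A. R v u}"

lemma graph_co: "graph R \<Longrightarrow> graph (co R)"
  by (auto simp: graph_def co_def symp_def irreflp_def)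

lemma co_co: "graph R \<Longrightarrow> co (co R) = R"
  by (auto simp: graph_def co_def irreflp_def fun_eq_iff)

lemma nbs_subset: "nbs R v A \<subseteq> A"
  by (auto simp: nbs_def)

lemma finite_nbs [simp]: "finite A \<Longrightarrow> finite (nbs R v A)"
  by (simp add: nbs_def)

lemma card_nbs_le: "finite A \<Longrightarrow> card (nbs R v A) \<le> card A"
  by (simp add: card_mono nbs_subset)

lemma not_in_nbs: "graph R \<Longrightarrow> v \<notin> nbs R v A"
  by (auto simp: graph_def irreflp_def nbs_def)

lemma card_nbs_less: "finite A \<Longrightarrow> graph R \<Longrightarrow> v \<in> A \<Longrightarrow> card (nbs R v A) < card A"
  by (intro psubset_card_mono psubsetI nbs_subset) (use not_in_nbs in fastforce)+

lemma has_clique_0 [simp]: "has_clique R V 0"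
  by (auto simp: has_clique_def intro: exI[of _ "{}"])

lemma has_clique_mono: "has_clique R V k \<Longrightarrow> V \<subseteq> W \<Longrightarrow> has_clique R W k"
  unfolding has_clique_def by blast

lemma has_clique_le:
  assumes "has_clique R V k" "j \<le> k"
  shows "has_clique R V j"
proof -
  obtain K where K: "K \<subseteq> V" "finite K" "card K = k" "\<forall>x\<in>K. \<forall>y\<in>K. x \<noteq> y \<longrightarrow> R x y"
    using assms by (auto simp: has_clique_def)
  obtain J where "J \<subseteq> K" "card J = j" "finite J"
    using obtain_subset_with_card_n[of j K] K assms by blast
  then show ?thesis
    using K unfolding has_clique_def by (intro exI[of _ J]) blast
qed

lemma has_clique_union:
  assumes "graph R" "has_clique R S s" "has_clique R T t"
    and "\<And>x y. x \<in> S \<Longrightarrow> y \<in> T \<Longrightarrow> R x y"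
  shows "has_clique R (S \<union> T) (s + t)"
proof -
  obtain K where K: "K \<subseteq> S" "finite K" "card K = s" "\<forall>x\<in>K. \<forall>y\<in>K. x \<noteq> y \<longrightarrow> R x y"
    using assms by (auto simp: has_clique_def)
  obtain L where L: "L \<subseteq> T" "finite L" "card L = t" "\<forall>x\<in>L. \<forall>y\<in>L. x \<noteq> y \<longrightarrow> R x y"
    using assms by (auto simp: has_clique_def)
  have "K \<inter> L = {}"
    using assms(1,4) K(1) L(1) unfolding graph_def irreflp_def by blast
  then have "card (K \<union> L) = s + t"
    using K L by (simp add: card_Un_disjoint)
  moreover have "R y x" if "x \<in> S" "y \<in> T" for x y
    using assms(1,4) that unfolding graph_def by (meson sympE)
  ultimately show ?thesis
    using K L assms(4) unfolding has_clique_def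
    by (intro exI[of _ "K \<union> L"]) blast
qed

lemma has_clique_singleton: "has_clique R {v} 1"
  unfolding has_clique_def by (intro exI[of _ "{v}"]) auto

lemma has_clique_nbs:
  assumes "graph R" "has_clique R A k" "A \<subseteq> nbs R v W" "v \<in> V" "A \<subseteq> V"
  shows "has_clique R V (Suc k)"
proof -
  have "has_clique R ({v} \<union> A) (1 + k)"
    using assms by (intro has_clique_union has_clique_singleton) (auto simp: nbs_def)
  then show ?thesis
    using assms by (auto elim: has_clique_mono)
qed

text \<open>In the usual notation: the off-diagonal Ramsey numbers satisfy r(k,l) \<open>\<le>\<close> C a^(-k) b^(-l).
  An unspecified constant suffices throughout, because every numerical inequality used below holds
  with room to spare.\<close>

definition ramsey_bound :: "real \<Rightarrow> real \<Rightarrow> bool" where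
  "ramsey_bound a b \<longleftrightarrow> (\<exists>C. \<forall>(R :: nat \<Rightarrow> nat \<Rightarrow> bool) V k l. graph R \<longrightarrow> finite V \<longrightarrow>
     C \<le> real (card V) * a ^ k * b ^ l \<longrightarrow> has_clique R V k \<or> has_clique (co R) V l)"

lemma ramsey_bound_swap:
  assumes "ramsey_bound a b" shows "ramsey_bound b a"
proof -
  obtain C where C: "\<And>(R :: nat \<Rightarrow> nat \<Rightarrow> bool) V k l. graph R \<Longrightarrow> finite V \<Longrightarrow>
     C \<le> real (card V) * a ^ k * b ^ l \<Longrightarrow> has_clique R V k \<or> has_clique (co R) V l"
    using assms unfolding ramsey_bound_def by blast
  show ?thesis unfolding ramsey_bound_def
  proof (intro exI[of _ C] allI impI)
    fix R :: "nat \<Rightarrow> nat \<Rightarrow> bool" and V :: "nat set" and k l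
    assume "graph R" "finite V" "C \<le> real (card V) * b ^ k * a ^ l"
    then show "has_clique R V k \<or> has_clique (co R) V l"
      using C[of "co R" V l k] by (auto simp: graph_co co_co mult_ac)
  qed
qed

text \<open>The square of |V| x^k y^l is at most the product of the same quantities for (a, b) and
  (c, d). One of these two therefore reaches the common constant, and its bound supplies the
  clique.\<close>

lemma ramsey_bound_geometric_mean:
  assumes "ramsey_bound a b" "ramsey_bound c d" "x\<^sup>2 \<le> a * c" "y\<^sup>2 \<le> b * d"
    and pos: "0 \<le> a" "0 \<le> b" "0 \<le> c" "0 \<le> d" "0 \<le> x" "0 \<le> y"
  shows "ramsey_bound x y"
proof -
  obtain C where C: "\<And>(R :: nat \<Rightarrow> nat \<Rightarrow> bool) V k l. graph R \<Longrightarrow> finite V \<Longrightarrow>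
     C \<le> real (card V) * a ^ k * b ^ l \<Longrightarrow> has_clique R V k \<or> has_clique (co R) V l"
    using assms(1) unfolding ramsey_bound_def by blast
  obtain D where D: "\<And>(R :: nat \<Rightarrow> nat \<Rightarrow> bool) V k l. graph R \<Longrightarrow> finite V \<Longrightarrow>
     D \<le> real (card V) * c ^ k * d ^ l \<Longrightarrow> has_clique R V k \<or> has_clique (co R) V l"
    using assms(2) unfolding ramsey_bound_def by blast
  \<comment> \<open>The entry 0 makes \<open>E\<close> nonnegative, so that the hypothesis may be
    squared.\<close>
  define E where "E = max C (max D 0)"
  show ?thesis unfolding ramsey_bound_def
  proof (intro exI[of _ E] allI impI)
    fix R :: "nat \<Rightarrow> nat \<Rightarrow> bool" and V :: "nat set" and k l
    assume R: "graph R" "finite V" and le: "E \<le> real (card V) * x ^ k * y ^ l"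
    let ?n = "real (card V)"
    have "E\<^sup>2 \<le> (?n * x ^ k * y ^ l)\<^sup>2"
      using le by (intro power_mono) (auto simp: E_def)
    also have "\<dots> = ?n\<^sup>2 * (x\<^sup>2) ^ k * (y\<^sup>2) ^ l"
      by (simp add: power_mult_distrib flip: power_mult) (simp add: mult.commute)
    also have "\<dots> \<le> ?n\<^sup>2 * (a * c) ^ k * (b * d) ^ l"
      using assms by (intro mult_mono power_mono) auto
    also have "\<dots> = (?n * a ^ k * b ^ l) * (?n * c ^ k * d ^ l)"
      by (simp add: power_mult_distrib power2_eq_square)
    finally have *: "E\<^sup>2 \<le> (?n * a ^ k * b ^ l) * (?n * c ^ k * d ^ l)" .
    have "E \<le> ?n * a ^ k * b ^ l \<or> E \<le> ?n * c ^ k * d ^ l"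
    proof (rule ccontr)
      assume "\<not> ?thesis"
      then have "(?n * a ^ k * b ^ l) * (?n * c ^ k * d ^ l) < E * E"
        using pos by (intro mult_strict_mono') auto
      with * show False by (simp add: power2_eq_square)
    qed
    then show "has_clique R V k \<or> has_clique (co R) V l"
      using C[OF R, of k l] D[OF R, of k l] by (auto simp: E_def)
  qed
qed

text \<open>The summand 1 next to the number of vertices makes the induction close without a loss: it
  absorbs the vertex whose neighbourhoods are taken.\<close>

lemma erdos_szekeres:
  fixes R :: "'a \<Rightarrow> 'a \<Rightarrow> bool"
  assumes "graph R" "finite V" "0 < s" "0 < t" "s + t \<le> 1"
    and "2 \<le> (real (card V) + 1) * s ^ k * t ^ l"
  shows "has_clique R V k \<or> has_clique (co R) V l"
  using assms(2,6)
proof (induction "k + l" arbitrary: k l V)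
  case (Suc n)
  show ?case
  proof (cases "k = 0 \<or> l = 0")
    case False
    then obtain k' l' where kl: "k = Suc k'" "l = Suc l'"
      by (meson not0_implies_Suc)
    have "s ^ k * t ^ l \<le> 1"
      using assms by (intro mult_le_one power_le_one) auto
    then have "(real (card V) + 1) * (s ^ k * t ^ l) \<le> (real (card V) + 1) * 1"
      by (intro mult_left_mono) auto
    moreover have "2 \<le> (real (card V) + 1) * (s ^ k * t ^ l)"
      using Suc.prems by (simp only: mult.assoc)
    ultimately have "2 \<le> (real (card V) + 1) * 1"
      by (rule order_trans[rotated])
    then have "card V \<ge> 1"
      by simp
    then obtain v where v: "v \<in> V" by fastforce
    let ?A = "nbs R v V" and ?B = "nbs (co R) v V"
    have "card V = card (insert v (?A \<union> ?B))"
      using v by (intro arg_cong[where f = card]) (auto simp: nbs_def co_def)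
    also have "\<dots> = Suc (card ?A + card ?B)"
      using Suc.prems assms(1) not_in_nbs[OF assms(1), of v V]
        not_in_nbs[OF graph_co[OF assms(1)], of v V]
      by (subst card_insert_disjoint) (auto simp: nbs_def co_def intro!: card_Un_disjoint)
    finally have cV: "real (card V) = card ?A + card ?B + 1" by simp
    let ?P = "s ^ k' * t ^ l'"
    have "2 * (s + t) \<le> 2"
      using assms by simp
    also have "\<dots> \<le> ((real (card ?A) + 1) + (real (card ?B) + 1)) * (s * t * ?P)"
      using Suc.prems kl cV by (simp add: mult_ac)
    finally have *: "2 * (s + t) \<le> (real (card ?A) + 1) * (s * t * ?P) + (real (card ?B) + 1) * (s * t * ?P)"
      by (simp only: distrib_right)
    \<comment> \<open>The sum is split in proportion s : t. Dividing by s in the red case then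
      removes exactly the factor s that lowering k gives up; likewise with t in the blue
      case.\<close>
    then consider "2 * s \<le> (real (card ?A) + 1) * (s * t * ?P)"
      | "2 * t \<le> (real (card ?B) + 1) * (s * t * ?P)"
      by fastforce
    then show ?thesis
    proof cases
      case 1
      then have "s * 2 \<le> s * ((real (card ?A) + 1) * s ^ k' * t ^ l)"
        by (simp add: kl mult_ac)
      then have "2 \<le> (real (card ?A) + 1) * s ^ k' * t ^ l"
        using assms by simp
      then have "has_clique R ?A k' \<or> has_clique (co R) ?A l"
        using Suc.hyps(2) kl Suc.prems by (intro Suc.hyps(1)) auto
      then show ?thesis
        using has_clique_nbs[OF assms(1) _ order_refl v nbs_subset] kl
        by (meson has_clique_mono nbs_subset)
    next
      case 2
      then have "t * 2 \<le> t * ((real (card ?B) + 1) * s ^ k * t ^ l')"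
        by (simp add: kl mult_ac)
      then have "2 \<le> (real (card ?B) + 1) * s ^ k * t ^ l'"
        using assms by simp
      then have "has_clique R ?B k \<or> has_clique (co R) ?B l'"
        using Suc.hyps(2) kl Suc.prems by (intro Suc.hyps(1)) auto
      then show ?thesis
        using has_clique_nbs[OF graph_co[OF assms(1)] _ order_refl v nbs_subset] kl
        by (meson has_clique_mono nbs_subset)
    qed
  qed auto
qed auto

lemma ramsey_bound_erdos_szekeres:
  assumes "0 < s" "0 < t" "s + t \<le> 1"
  shows "ramsey_bound s t"
  unfolding ramsey_bound_def
proof (intro exI[of _ 2] allI impI)
  fix R :: "nat \<Rightarrow> nat \<Rightarrow> bool" and V :: "nat set" and k l
  assume R: "graph R" "finite V" "2 \<le> real (card V) * s ^ k * t ^ l"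
  moreover have "0 \<le> s ^ k * t ^ l"
    using assms by simp
  ultimately have "2 \<le> (real (card V) + 1) * s ^ k * t ^ l"
    by (simp add: distrib_right mult.assoc)
  then show "has_clique R V k \<or> has_clique (co R) V l"
    using erdos_szekeres[OF R(1,2) assms] by blast
qed

section \<open>Excess density\<close>

lemma weighted_arith_geo_mean:
  fixes a b h :: real
  assumes "0 \<le> a" "0 \<le> b" "0 < h" "h < 1"
  shows "a powr (1 - h) * b powr h \<le> (1 - h) * a + h * b"
proof (cases "a = 0 \<or> b = 0")
  case True
  then show ?thesis using assms by auto
next
  case False
  then show ?thesis
    using assms Youngs_inequality_0[of "1 - h" h a b] by auto
qed

text \<open>The number of red pairs minus p |X| |Y|. Pairs are ordered and the two sets may overlap,
  since the argument starts with both equal to V. The unnormalised sum is additive in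
  \<open>X\<close>.\<close>

definition excess :: "('a \<Rightarrow> 'a \<Rightarrow> bool) \<Rightarrow> real \<Rightarrow> 'a set \<Rightarrow> 'a set \<Rightarrow> real" where
  "excess R p X Y = (\<Sum>x\<in>X. \<Sum>y\<in>Y. of_bool (R x y) - p)"

lemma excess_le:
  assumes "0 \<le> p"
  shows "excess R p X Y \<le> real (card X) * real (card Y)"
proof -
  have "excess R p X Y \<le> (\<Sum>x\<in>X. \<Sum>y\<in>Y. 1)"
    unfolding excess_def using assms by (intro sum_mono) (auto simp: of_bool_def)
  then show ?thesis by simp
qed

lemma card_nbs: "finite A \<Longrightarrow> real (card (nbs R v A)) = (\<Sum>u\<in>A. of_bool (R v u))"
  unfolding nbs_def by (subst sum_of_bool_eq) (auto simp: Int_def)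

lemma excess_degrees:
  assumes "finite Y"
  shows "excess R p X Y = (\<Sum>x\<in>X. real (card (nbs R x Y)) - p * card Y)"
  unfolding excess_def using assms by (simp add: card_nbs sum_subtractf mult.commute)

lemma excess_union:
  "finite X \<Longrightarrow> finite X' \<Longrightarrow> X \<inter> X' = {} \<Longrightarrow>
    excess R p (X \<union> X') Y = excess R p X Y + excess R p X' Y"
  unfolding excess_def by (rule sum.union_disjoint)

lemma sum_filter_of_bool:
  fixes g :: "'a \<Rightarrow> real"
  assumes "finite A"
  shows "(\<Sum>x\<in>{x\<in>A. P x}. g x) = (\<Sum>x\<in>A. of_bool (P x) * g x)"
  unfolding sum.inter_filter[OF assms] by (rule sum.cong) auto

text \<open>Expressed through the red degrees a y of the vertices y of \<open>Y\<close> into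
  \<open>X\<close>, this is the Cauchy-Schwarz inequality. Pooled over all v in \<open>X\<close>,
  the red density from \<open>X\<close> to the neighbourhoods of v is at least that from
  \<open>X\<close> to \<open>Y\<close>.\<close>

lemma sum_excess_nbs_ge:
  assumes "finite X" "finite Y"
  shows "(\<Sum>v\<in>X. real (card (nbs R v Y))) * excess R p X Y
    \<le> card Y * (\<Sum>v\<in>X. excess R p X (nbs R v Y))"
proof -
  define a :: "'a \<Rightarrow> real" where "a y = (\<Sum>x\<in>X. of_bool (R x y))" for y
  let ?n = "real (card X)"
  have E: "(\<Sum>v\<in>X. real (card (nbs R v Y))) = (\<Sum>y\<in>Y. a y)"
    unfolding a_def by (simp only: card_nbs[OF assms(2)]) (rule sum.swap)
  have ex: "excess R p X Y = (\<Sum>y\<in>Y. a y) - p * ?n * card Y"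
    unfolding excess_def a_def by (subst sum.swap) (simp add: sum_subtractf)
  have inner: "(\<Sum>x\<in>X. of_bool (R x y) - p) = a y - p * ?n" for y
    by (simp only: a_def sum_subtractf) simp
  have "(\<Sum>v\<in>X. excess R p X (nbs R v Y))
      = (\<Sum>v\<in>X. \<Sum>y\<in>nbs R v Y. \<Sum>x\<in>X. of_bool (R x y) - p)"
    unfolding excess_def by (intro sum.cong refl sum.swap)
  also have "\<dots> = (\<Sum>v\<in>X. \<Sum>y\<in>Y. of_bool (R v y) * (a y - p * ?n))"
  proof (rule sum.cong[OF refl])
    fix v
    show "(\<Sum>y\<in>nbs R v Y. \<Sum>x\<in>X. of_bool (R x y) - p) = (\<Sum>y\<in>Y. of_bool (R v y) * (a y - p * ?n))"
      unfolding nbs_def sum_filter_of_bool[OF assms(2)] by (simp only: inner)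
  qed
  also have "\<dots> = (\<Sum>y\<in>Y. a y * (a y - p * ?n))"
    by (subst sum.swap) (simp add: a_def sum_distrib_right)
  also have "\<dots> = (\<Sum>y\<in>Y. (a y)\<^sup>2) - p * ?n * (\<Sum>y\<in>Y. a y)"
    by (simp add: right_diff_distrib sum_subtractf sum_distrib_left sum_distrib_right
        power2_eq_square mult_ac)
  finally have "(\<Sum>v\<in>X. excess R p X (nbs R v Y))
      = (\<Sum>y\<in>Y. (a y)\<^sup>2) - p * ?n * (\<Sum>y\<in>Y. a y)" .
  then have "card Y * (\<Sum>v\<in>X. excess R p X (nbs R v Y))
      = (\<Sum>y\<in>Y. (a y)\<^sup>2) * card Y - p * ?n * card Y * (\<Sum>y\<in>Y. a y)"
    by (simp only: right_diff_distrib) (simp add: mult_ac)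
  moreover have "(\<Sum>y\<in>Y. a y)\<^sup>2 \<le> (\<Sum>y\<in>Y. (a y)\<^sup>2) * card Y"
    by (rule sum_squared_le_sum_of_squares)
  ultimately show ?thesis
    unfolding E ex by (simp add: algebra_simps power2_eq_square)
qed

text \<open>Here r and \<open>\<beta>\<close> are the red and blue degrees of a vertex, relative to |X|. Under the
  constraint \<open>\<beta> \<le> M\<close> the left-hand side is largest at \<open>\<beta> = M\<close>.\<close>

lemma split_ratio_bound:
  fixes r \<beta> x M h :: real
  assumes "0 \<le> r" "0 \<le> \<beta>" "\<beta> \<le> M" "r + \<beta> \<le> 1" "0 < x" "x \<le> 1 - M" "0 < h" "h < 1"
  shows "r powr (1 - h) * x powr h + \<beta> powr (1 - h) * M powr h
    \<le> (1 - M) powr (1 - h) * x powr h + M"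
proof -
  define q where "q = 1 - M"
  define S where "S = q powr (1 - h) * x powr h"
  have q: "0 < q" using assms by (simp add: q_def)
  have S0: "0 \<le> S" by (simp add: S_def)
  have "S \<le> q powr (1 - h) * q powr h"
    unfolding S_def using assms by (intro mult_left_mono powr_mono2) (auto simp: q_def)
  also have "\<dots> = q"
    using q by (simp flip: powr_add)
  finally have Sq: "S \<le> q" .
  have "((1 - \<beta>) / q) powr (1 - h) * 1 powr h \<le> (1 - h) * ((1 - \<beta>) / q) + h * 1"
    using assms q by (intro weighted_arith_geo_mean) auto
  then have *: "((1 - \<beta>) / q) powr (1 - h) \<le> 1 + (1 - h) * (M - \<beta>) / q"
    using q by (simp add: q_def field_simps)
  have "r powr (1 - h) * x powr h \<le> (1 - \<beta>) powr (1 - h) * x powr h"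
    using assms by (intro mult_right_mono powr_mono2) auto
  also have "\<dots> = (q * ((1 - \<beta>) / q)) powr (1 - h) * x powr h"
    using q by simp
  also have "\<dots> = S * ((1 - \<beta>) / q) powr (1 - h)"
    using q assms unfolding S_def by (subst powr_mult) auto
  also have "\<dots> \<le> S * (1 + (1 - h) * (M - \<beta>) / q)"
    using * S0 by (rule mult_left_mono)
  also have "\<dots> = S + (S / q) * ((1 - h) * (M - \<beta>))"
    by (simp add: distrib_left)
  also have "\<dots> \<le> S + 1 * ((1 - h) * (M - \<beta>))"
    using Sq q assms by (intro add_left_mono mult_right_mono) auto
  finally have 1: "r powr (1 - h) * x powr h \<le> S + (1 - h) * (M - \<beta>)" by simp
  have 2: "\<beta> powr (1 - h) * M powr h \<le> (1 - h) * \<beta> + h * M"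
    using assms by (intro weighted_arith_geo_mean) auto
  from 1 2 show ?thesis
    unfolding S_def q_def by (simp add: algebra_simps)
qed

text \<open>If both moves failed at every v, then for v outside \<open>W\<close> the excess of
  \<open>X\<close> against the red neighbourhood of v would be bounded by its red part, its blue
  part and the row of v. By \<open>gap\<close>, the two main parts summed over v miss the lower
  bound of \<open>sum_excess_nbs_ge\<close> by a proportion \<kappa>, and the rows together with
  \<open>W\<close> are too small to fill this deficit.\<close>

lemma exists_good_vertex:
  fixes p x M h \<kappa> :: real
  assumes R: "graph R" and fin: "finite X" "finite Y" and W: "W \<subseteq> X"
    and p: "0 < p" and M: "0 < M" and x: "0 < x" "x \<le> 1 - M" and h: "0 < h" "h < 1"
    and gap: "0 < \<kappa>" "(1 - M) powr (1 - h) * x powr h + M \<le> (1 - \<kappa>) * p powr h"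
    and deg: "\<And>v. v \<in> X - W \<Longrightarrow> real (card (nbs (co R) v X)) \<le> M * card X"
    and f: "0 < excess R p X Y" "(1 + real (card W)) * card Y < \<kappa> * p * excess R p X Y"
  obtains v where "v \<in> X"
    "x powr h * excess R p X Y * ((real (card (nbs R v X)) * real (card (nbs R v Y)))
        / (real (card X) * real (card Y))) powr (1 - h) < excess R p (nbs R v X) (nbs R v Y)"
  | v where "v \<in> X"
    "M powr h * excess R p X Y * ((real (card (nbs (co R) v X)) * real (card (nbs R v Y)))
        / (real (card X) * real (card Y))) powr (1 - h) < excess R p (nbs (co R) v X) (nbs R v Y)"
proof (rule ccontr)
  assume neg: "\<not> thesis"
  note red = that(1) and blue = that(2)
  let ?f = "excess R p X Y"
  let ?n = "real (card X)" and ?N = "real (card Y)"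
  define S where "S = (1 - M) powr (1 - h) * x powr h"
  define \<delta> where "\<delta> v = card (nbs R v Y) / ?N" for v
  have nN: "0 < ?n" "0 < ?N"
    using f(1) fin by (auto simp: excess_def card_gt_0_iff)
  have \<delta>0: "0 \<le> \<delta> v" for v by (simp add: \<delta>_def)
  \<comment> \<open>\<open>d\<close> is the red density between \<open>X\<close> and
    \<open>Y\<close>, hence the average over \<open>X\<close> of the relative degrees
    \<open>\<delta> v\<close>.\<close>
  define d where "d = p + ?f / (?n * ?N)"
  have d: "p < d" using f nN by (simp add: d_def)
  have "?f = (\<Sum>v\<in>X. real (card (nbs R v Y))) - p * ?n * ?N"
    using fin by (simp add: excess_degrees sum_subtractf)
  then have E: "(\<Sum>v\<in>X. real (card (nbs R v Y))) = d * ?n * ?N"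
    using nN by (simp add: d_def field_simps)
  then have sum\<delta>: "(\<Sum>v\<in>X. \<delta> v) = d * ?n"
    using nN unfolding \<delta>_def by (simp flip: sum_divide_distrib)
  have le: "excess R p X (nbs R v Y)
      \<le> (if v \<in> W then ?n * ?N else ?N) + ?f * (S + M) * \<delta> v powr (1 - h)"
    if v: "v \<in> X" for v
  proof (cases "v \<in> W")
    case True
    have "excess R p X (nbs R v Y) \<le> ?n * card (nbs R v Y)"
      using p by (intro excess_le) simp
    also have "\<dots> \<le> ?n * ?N"
      using fin by (intro mult_left_mono) (auto simp: card_nbs_le)
    finally have "excess R p X (nbs R v Y) \<le> ?n * ?N" .
    moreover have "0 \<le> ?f * (S + M) * \<delta> v powr (1 - h)"
      using f M by (intro mult_nonneg_nonneg add_nonneg_nonneg) (auto simp: S_def)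
    ultimately show ?thesis using True by simp
  next
    case False
    let ?Xr = "nbs R v X" and ?Xb = "nbs (co R) v X" and ?Y = "nbs R v Y"
    let ?r = "card ?Xr / ?n" and ?\<beta> = "card ?Xb / ?n"
    have Xeq: "X = {v} \<union> (?Xr \<union> ?Xb)"
      using v by (auto simp: nbs_def co_def)
    have disj: "{v} \<inter> (?Xr \<union> ?Xb) = {}" "?Xr \<inter> ?Xb = {}"
      using R by (auto simp: nbs_def co_def graph_def irreflp_def)
    have "card (?Xr \<union> ?Xb) = card ?Xr + card ?Xb"
      using disj fin by (intro card_Un_disjoint) auto
    moreover have "card (?Xr \<union> ?Xb) \<le> card X"
      using fin Xeq by (intro card_mono) auto
    ultimately have "real (card ?Xr) + real (card ?Xb) \<le> ?n" by linarith
    then have rb: "?r + ?\<beta> \<le> 1"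
      using nN by (simp flip: add_divide_distrib)
    have \<beta>: "?\<beta> \<le> M"
      using deg[of v] v False nN by (simp add: field_simps)
    have "excess R p X ?Y = excess R p {v} ?Y + (excess R p ?Xr ?Y + excess R p ?Xb ?Y)"
      using disj fin by (subst Xeq) (simp only: excess_union finite.intros finite_nbs finite_Un)
    moreover have "excess R p {v} ?Y \<le> ?N"
    proof -
      have "excess R p {v} ?Y \<le> card {v} * real (card ?Y)"
        using p by (intro excess_le) simp
      also have "\<dots> \<le> ?N"
        using fin by (simp add: card_nbs_le)
      finally show ?thesis .
    qed
    moreover have "excess R p ?Xr ?Y \<le> x powr h * ?f * (?r * \<delta> v) powr (1 - h)"
      by (rule ccontr) (use neg red[OF v] in \<open>auto simp: \<delta>_def\<close>)
    moreover have "excess R p ?Xb ?Y \<le> M powr h * ?f * (?\<beta> * \<delta> v) powr (1 - h)"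
      by (rule ccontr) (use neg blue[OF v] in \<open>auto simp: \<delta>_def\<close>)
    ultimately have "excess R p X ?Y
        \<le> ?N + (x powr h * ?f * (?r * \<delta> v) powr (1 - h) + M powr h * ?f * (?\<beta> * \<delta> v) powr (1 - h))"
      by linarith
    also have "\<dots> = ?N + ?f * (?r powr (1 - h) * x powr h + ?\<beta> powr (1 - h) * M powr h) * \<delta> v powr (1 - h)"
      using nN \<delta>0[of v] by (simp only: powr_mult) (simp add: algebra_simps)
    also have "\<dots> \<le> ?N + ?f * (S + M) * \<delta> v powr (1 - h)"
      unfolding S_def using f nN rb \<beta> x h
      by (intro add_left_mono mult_right_mono mult_left_mono split_ratio_bound) auto
    finally show ?thesis using False by simp
  qed
  have "d * ?n * ?N * ?f \<le> ?N * (\<Sum>v\<in>X. excess R p X (nbs R v Y))"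
    using sum_excess_nbs_ge[OF fin, of R p] by (simp add: E)
  then have "d * ?n * ?f \<le> (\<Sum>v\<in>X. excess R p X (nbs R v Y))"
    using nN by (simp add: mult_ac)
  also have "\<dots> \<le> (\<Sum>v\<in>X. (if v \<in> W then ?n * ?N else ?N) + ?f * (S + M) * \<delta> v powr (1 - h))"
    by (intro sum_mono le)
  also have "\<dots> = (\<Sum>v\<in>X. if v \<in> W then ?n * ?N else ?N) + ?f * ((S + M) * (\<Sum>v\<in>X. \<delta> v powr (1 - h)))"
    by (simp add: sum.distrib sum_distrib_left mult.assoc)
  also have "(\<Sum>v\<in>X. if v \<in> W then ?n * ?N else ?N) \<le> (1 + real (card W)) * ?n * ?N"
  proof -
    have "(\<Sum>v\<in>X. if v \<in> W then ?n * ?N else ?N) \<le> (\<Sum>v\<in>X. (if v \<in> W then ?n * ?N else 0) + ?N)"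
      by (intro sum_mono) auto
    also have "\<dots> = real (card W) * (?n * ?N) + ?n * ?N"
      using fin W by (simp add: sum.distrib sum.If_cases Int_absorb1)
    finally show ?thesis by (simp add: algebra_simps)
  qed
  also have "(S + M) * (\<Sum>v\<in>X. \<delta> v powr (1 - h)) \<le> (1 - \<kappa>) * (?n * d)"
  proof -
    have SM: "0 < S + M" using M by (simp add: S_def add_nonneg_pos)
    have \<kappa>1: "0 \<le> 1 - \<kappa>"
    proof (rule ccontr)
      assume "\<not> 0 \<le> 1 - \<kappa>"
      then have "(1 - \<kappa>) * p powr h \<le> 0" by (simp add: mult_nonpos_nonneg)
      then show False using SM gap by (simp add: S_def)
    qed
    have "(S + M) * (\<Sum>v\<in>X. \<delta> v powr (1 - h)) \<le> ((1 - \<kappa>) * p powr h) * (\<Sum>v\<in>X. \<delta> v powr (1 - h))"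
      using gap by (intro mult_right_mono sum_nonneg) (auto simp: S_def)
    \<comment> \<open>Replacing p^h by d^h makes each summand a weighted geometric mean of
      \<open>\<delta> v\<close> and \<open>d\<close>; the corresponding arithmetic means average to
      exactly \<open>d\<close>.\<close>
    also have "\<dots> \<le> ((1 - \<kappa>) * d powr h) * (\<Sum>v\<in>X. \<delta> v powr (1 - h))"
      using \<kappa>1 d p h by (intro mult_right_mono mult_left_mono powr_mono2 sum_nonneg) auto
    also have "\<dots> = (1 - \<kappa>) * (\<Sum>v\<in>X. \<delta> v powr (1 - h) * d powr h)"
      by (simp add: sum_distrib_left sum_distrib_right mult_ac)
    also have "\<dots> \<le> (1 - \<kappa>) * (\<Sum>v\<in>X. (1 - h) * \<delta> v + h * d)"
      using \<kappa>1 d p h \<delta>0 by (intro mult_left_mono sum_mono weighted_arith_geo_mean) auto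
    also have "(\<Sum>v\<in>X. (1 - h) * \<delta> v + h * d) = ?n * d"
      by (simp add: sum.distrib sum\<delta> flip: sum_distrib_left) (simp add: algebra_simps)
    finally show ?thesis .
  qed
  finally have "d * ?n * ?f \<le> (1 + real (card W)) * ?n * ?N + ?f * ((1 - \<kappa>) * (?n * d))"
    using f by (simp add: mult_left_mono)
  then have "?n * (\<kappa> * d * ?f) \<le> ?n * ((1 + real (card W)) * ?N)"
    by (simp add: algebra_simps)
  then have "\<kappa> * d * ?f \<le> (1 + real (card W)) * ?N"
    using nN by simp
  moreover have "\<kappa> * p * ?f \<le> \<kappa> * d * ?f"
    using gap f d by (intro mult_right_mono mult_left_mono) auto
  ultimately show False using f by linarith
qed

section \<open>Books: few vertices with many common neighbours\<close>

lemma power_tangent_le: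
  fixes c g :: real
  assumes "0 < c" "0 \<le> g"
  shows "c ^ b + b * c ^ (b - 1) * (g - c) \<le> g ^ b"
proof (cases b)
  case (Suc b')
  have "1 + real b * (g / c - 1) \<le> (1 + (g / c - 1)) ^ b"
    using assms by (intro Bernoulli_inequality) simp
  then have "c ^ b * (1 + real b * (g / c - 1)) \<le> c ^ b * (g / c) ^ b"
    using assms by (intro mult_left_mono) auto
  also have "c ^ b * (g / c) ^ b = g ^ b"
    using assms by (simp add: power_divide)
  also have "c ^ b * (1 + real b * (g / c - 1)) = c ^ b + b * c ^ (b - 1) * (g - c)"
    using assms by (simp add: Suc field_simps)
  finally show ?thesis .
qed simp

text \<open>By double counting, a vertex of \<open>X\<close> has on average at least M |U|
  neighbours in \<open>U\<close>. Convexity of the b-th power bounds the total weight of choices of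
  b such neighbours below by (M |U| - b)^b |X|, and a greedy choice of the b vertices receives at
  least the fraction |U|^(-b) of it.\<close>

lemma exists_book:
  fixes M :: real
  assumes Q: "graph Q" and fin: "finite X" and U: "U \<subseteq> X"
    and M: "0 < M" and b: "real b < M * card U"
    and deg: "\<And>u. u \<in> U \<Longrightarrow> M * card X \<le> real (card (nbs Q u X))"
  obtains S where "S \<subseteq> U" "card S = b"
    "(M - b / card U) ^ b * card X \<le> real (card {x \<in> X. \<forall>s\<in>S. Q s x})"
proof (cases "X = {}")
  case True
  then show ?thesis using that[of "{}"] U b by auto
next
  case False
  define m where "m = card U"
  \<comment> \<open>The subtraction is on naturals, so \<open>g\<close> is nonnegative. Taking off b
    in advance makes \<open>g x\<close> a lower bound for the neighbours of x in \<open>U\<close>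
    that are still unchosen at every stage.\<close>
  define g where "g x = real (card (nbs Q x U) - b)" for x
  define T where "T S = {x \<in> X. \<forall>s\<in>S. Q s x}" for S
  have finU: "finite U" using U fin finite_subset by blast
  have finT: "finite (T S)" for S using fin by (simp add: T_def)
  have m: "0 < m" using b by (auto simp: m_def intro!: gr0I)
  have "M * card X \<le> 1 * card X"
  proof -
    obtain u where "u \<in> U" using m by (auto simp: m_def card_gt_0_iff)
    then show ?thesis using deg[of u] card_nbs_le[OF fin, of Q u] by fastforce
  qed
  then have "M \<le> 1"
    using False fin by (simp add: card_gt_0_iff)
  then have "M * m \<le> 1 * real m" by (intro mult_right_mono) auto
  with b have bm: "b < m" by (simp add: m_def)
  \<comment> \<open>Greedy choice: each new vertex of the book is picked by averaging, where a vertex x still in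
    play has weight g x to the power of the number of vertices yet to be picked.\<close>
  have "\<exists>S\<subseteq>U. card S = j \<and> (\<Sum>x\<in>X. g x ^ b) \<le> m ^ j * (\<Sum>x\<in>T S. g x ^ (b - j))" if "j \<le> b" for j
    using that
  proof (induction j)
    case 0
    show ?case by (intro exI[of _ "{}"]) (simp add: T_def)
  next
    case (Suc j)
    then obtain S where S: "S \<subseteq> U" "card S = j"
      "(\<Sum>x\<in>X. g x ^ b) \<le> m ^ j * (\<Sum>x\<in>T S. g x ^ (b - j))" by auto
    define e where "e = b - Suc j"
    have bj: "b - j = Suc e" using Suc.prems by (simp add: e_def)
    have finS: "finite S" using S finU finite_subset by blast
    define G where "G = (\<Sum>x\<in>T S. g x ^ Suc e)"
    have G0: "0 \<le> G" unfolding G_def g_def by (intro sum_nonneg) auto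
    have "G \<le> (\<Sum>x\<in>T S. real (card {u\<in>U - S. Q u x}) * g x ^ e)"
      unfolding G_def power_Suc
    proof (intro sum_mono mult_right_mono)
      fix x assume "x \<in> T S"
      have "nbs Q x U \<subseteq> {u\<in>U - S. Q u x} \<union> S"
        using Q unfolding nbs_def graph_def by (auto dest: sympD)
      then have "card (nbs Q x U) \<le> card ({u\<in>U - S. Q u x} \<union> S)"
        using finU finS by (intro card_mono) auto
      also have "\<dots> \<le> card {u\<in>U - S. Q u x} + card S"
        by (rule card_Un_le)
      finally show "g x \<le> real (card {u\<in>U - S. Q u x})"
        using S Suc.prems by (simp add: g_def)
    qed (simp add: g_def)
    also have "\<dots> = (\<Sum>x\<in>T S. \<Sum>u\<in>U - S. of_bool (Q u x) * g x ^ e)"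
      using finU by (simp add: sum_of_bool_eq Int_def flip: sum_distrib_right)
    also have "\<dots> = (\<Sum>u\<in>U - S. \<Sum>x\<in>T S. of_bool (Q u x) * g x ^ e)"
      by (rule sum.swap)
    also have "\<dots> = (\<Sum>u\<in>U - S. \<Sum>x\<in>T (insert u S). g x ^ e)"
    proof (rule sum.cong[OF refl])
      fix u
      have "T (insert u S) = {x \<in> T S. Q u x}" by (auto simp: T_def)
      then show "(\<Sum>x\<in>T S. of_bool (Q u x) * g x ^ e) = (\<Sum>x\<in>T (insert u S). g x ^ e)"
        by (simp only: sum_filter_of_bool[OF finT])
    qed
    finally have Gle: "G \<le> (\<Sum>u\<in>U - S. \<Sum>x\<in>T (insert u S). g x ^ e)" .
    have "\<exists>u\<in>U - S. G \<le> m * (\<Sum>x\<in>T (insert u S). g x ^ e)"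
    proof (rule ccontr)
      assume "\<not> ?thesis"
      then have lt: "m * (\<Sum>x\<in>T (insert u S). g x ^ e) < G" if "u \<in> U - S" for u
        using that by force
      have "card S < card U" using S Suc.prems bm by (simp add: m_def)
      then have "U - S \<noteq> {}"
        using S(1) by (metis Diff_eq_empty_iff less_irrefl subset_antisym)
      then have "(\<Sum>u\<in>U - S. m * (\<Sum>x\<in>T (insert u S). g x ^ e)) < (\<Sum>u\<in>U - S. G)"
        using finU lt by (intro sum_strict_mono) auto
      also have "\<dots> \<le> m * G"
        using G0 finU by (auto intro!: mult_right_mono card_mono simp: m_def)
      finally have "m * (\<Sum>u\<in>U - S. \<Sum>x\<in>T (insert u S). g x ^ e) < m * G"
        by (simp add: sum_distrib_left)
      then show False using Gle by (simp add: mult_less_cancel_left)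
    qed
    then obtain u where u: "u \<in> U - S" "G \<le> m * (\<Sum>x\<in>T (insert u S). g x ^ e)" by blast
    have "(\<Sum>x\<in>X. g x ^ b) \<le> m ^ j * G"
      using S by (simp add: G_def bj)
    also have "\<dots> \<le> m ^ j * (m * (\<Sum>x\<in>T (insert u S). g x ^ e))"
      using u by (intro mult_left_mono) auto
    finally have "(\<Sum>x\<in>X. g x ^ b) \<le> m ^ Suc j * (\<Sum>x\<in>T (insert u S). g x ^ (b - Suc j))"
      by (simp add: e_def mult_ac)
    then show ?case
      using u S finS by (intro exI[of _ "insert u S"]) auto
  qed
  from this[of b] obtain S where S: "S \<subseteq> U" "card S = b" "(\<Sum>x\<in>X. g x ^ b) \<le> m ^ b * card (T S)"
    by auto
  \<comment> \<open>\<open>c\<close> bounds the average of \<open>g\<close> from below. The tangent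
    to the b-th power at \<open>c\<close> then gives Jensen's inequality.\<close>
  define c where "c = M * m - b"
  have c: "0 < c" using b by (simp add: c_def m_def)
  have "card X * c \<le> (\<Sum>u\<in>U. M * card X) - b * card X"
    by (simp add: c_def m_def algebra_simps)
  also have "\<dots> \<le> (\<Sum>u\<in>U. real (card (nbs Q u X))) - b * card X"
    using deg by (intro diff_right_mono sum_mono) auto
  also have "(\<Sum>u\<in>U. real (card (nbs Q u X))) = (\<Sum>x\<in>X. real (card (nbs Q x U)))"
  proof -
    have "(\<Sum>u\<in>U. real (card (nbs Q u X))) = (\<Sum>u\<in>U. \<Sum>x\<in>X. of_bool (Q u x))"
      using fin by (simp only: card_nbs)
    also have "\<dots> = (\<Sum>u\<in>U. \<Sum>x\<in>X. of_bool (Q x u))"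
      using Q unfolding graph_def by (intro sum.cong refl arg_cong[where f = of_bool]) (auto dest: sympD)
    also have "\<dots> = (\<Sum>x\<in>X. \<Sum>u\<in>U. of_bool (Q x u))"
      by (rule sum.swap)
    finally show ?thesis using finU by (simp only: card_nbs)
  qed
  also have "\<dots> - b * card X = (\<Sum>x\<in>X. real (card (nbs Q x U)) - b)"
    by (simp add: sum_subtractf)
  also have "\<dots> \<le> (\<Sum>x\<in>X. g x)"
    by (intro sum_mono) (simp add: g_def)
  finally have gc: "0 \<le> (\<Sum>x\<in>X. g x - c)"
    by (simp add: sum_subtractf)
  have "card X * c ^ b \<le> card X * c ^ b + b * c ^ (b - 1) * (\<Sum>x\<in>X. g x - c)"
    using gc c by simp
  also have "\<dots> = (\<Sum>x\<in>X. c ^ b + b * c ^ (b - 1) * (g x - c))"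
    by (simp add: sum.distrib sum_distrib_left)
  also have "\<dots> \<le> (\<Sum>x\<in>X. g x ^ b)"
    using c by (intro sum_mono power_tangent_le) (auto simp: g_def)
  also note S(3)
  also have "c = m * (M - b / m)"
    using m by (simp add: c_def field_simps)
  finally have "m ^ b * ((M - b / m) ^ b * card X) \<le> m ^ b * card (T S)"
    by (simp add: power_mult_distrib mult_ac)
  then have "(M - b / m) ^ b * card X \<le> card (T S)"
    using m by simp
  then show ?thesis
    using that[OF S(1,2)] by (simp add: T_def m_def)
qed

section \<open>The potential\<close>

text \<open>The excess density times (|X| |Y|)^h, with the division absorbed into the exponent; see
  \<open>potential_eq\<close>.\<close>

definition potential :: "('a \<Rightarrow> 'a \<Rightarrow> bool) \<Rightarrow> real \<Rightarrow> real \<Rightarrow> 'a set \<Rightarrow> 'a set \<Rightarrow> real" where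
  "potential R p h X Y = excess R p X Y * (real (card X) * real (card Y)) powr (h - 1)"

lemma potential_eq:
  assumes "0 < card X" "0 < card Y"
  shows "potential R p h X Y
    = excess R p X Y / (real (card X) * real (card Y)) * (real (card X) * real (card Y)) powr h"
  using assms by (simp add: potential_def powr_diff)

text \<open>The last hypothesis is the conclusion multiplied by (|X'| |Y'|)^(1 - h), the form in
  which averaging over vertices delivers it.\<close>

lemma potential_le:
  assumes "0 < card X" "0 < card Y" "0 < card X'" "0 < card Y'"
    and "c * excess R p X Y * ((real (card X') * real (card Y')) / (real (card X) * real (card Y))) powr (1 - h)
      \<le> excess R p X' Y'"
  shows "c * potential R p h X Y \<le> potential R p h X' Y'"
proof -
  let ?a = "real (card X') * real (card Y')" and ?b = "real (card X) * real (card Y)"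
  have ab: "0 < ?a" "0 < ?b" using assms by auto
  have "c * excess R p X Y * (?a / ?b) powr (1 - h) * ?a powr (h - 1)
      \<le> excess R p X' Y' * ?a powr (h - 1)"
    using assms(5) by (rule mult_right_mono) simp
  moreover have "(?a / ?b) powr (1 - h) * ?a powr (h - 1) = ?b powr (h - 1)"
  proof -
    have "(?a / ?b) powr (1 - h) = ?a powr (1 - h) * ?b powr (h - 1)"
      using ab by (subst powr_divide) (auto simp: divide_powr_uminus)
    moreover have "?a powr (1 - h) * ?a powr (h - 1) = 1"
      using assms(1-4) by (subst powr_add[symmetric]) auto
    ultimately show ?thesis by (simp add: mult_ac)
  qed
  ultimately show ?thesis
    unfolding potential_def by (simp add: mult.assoc)
qed

text \<open>Strictness forces \<open>X'\<close> and \<open>Y'\<close> to be nonempty: otherwise both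
  sides would be 0.\<close>

lemma potential_less:
  assumes "finite X" "finite Y" "finite X'" "finite Y'" "0 < excess R p X Y"
    and "c * excess R p X Y * ((real (card X') * real (card Y')) / (real (card X) * real (card Y))) powr (1 - h)
      < excess R p X' Y'"
  shows "c * potential R p h X Y \<le> potential R p h X' Y'"
proof (rule potential_le)
  have "X \<noteq> {}" "Y \<noteq> {}" using assms(5) by (auto simp: excess_def)
  then show "0 < card X" "0 < card Y" using assms by (auto simp: card_gt_0_iff)
  have "X' \<noteq> {}" "Y' \<noteq> {}" using assms(6) by (auto simp: excess_def)
  then show "0 < card X'" "0 < card Y'" using assms by (auto simp: card_gt_0_iff)
qed (use assms in auto)

text \<open>Dropping v multiplies |X| by q = 1 - 1/|X|. If the potential falls, the remaining
  vertices carry at most the fraction q^(1 - h) \<le> 1 - (1 - h)/|X| of the excess, and v carries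
  the rest.\<close>

lemma excess_vertex_ge:
  assumes fin: "finite X" "finite Y" and v: "v \<in> X" and h: "0 < h" "h < 1"
    and f: "0 < excess R p X Y"
    and lt: "potential R p h (X - {v}) Y < potential R p h X Y"
  shows "(1 - h) * excess R p X Y / card X \<le> excess R p {v} Y"
proof -
  let ?f = "excess R p X Y" and ?n = "real (card X)" and ?N = "real (card Y)"
  have nN: "0 < card X" "0 < card Y"
    using f fin by (auto simp: excess_def card_gt_0_iff)
  have f_eq: "?f = excess R p (X - {v}) Y + excess R p {v} Y"
    using fin v by (subst excess_union[symmetric]) (auto simp: insert_absorb)
  show ?thesis
  proof (cases "X = {v}")
    case True
    then show ?thesis using f h by (simp add: mult_left_le_one_le)
  next
    case False
    then have "X - {v} \<noteq> {}" using v by auto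
    with fin have "0 < card (X - {v})"
      by (simp only: card_gt_0_iff finite_Diff) simp
    moreover have "card (X - {v}) = card X - 1"
      using v by simp
    ultimately have c: "0 < card (X - {v})" "card (X - {v}) = card X - 1"
      by simp_all
    define q where "q = (?n - 1) / ?n"
    have q: "0 \<le> q" "real (card (X - {v})) * ?N / (?n * ?N) = q"
      using nN c by (auto simp: q_def of_nat_diff)
    have "excess R p (X - {v}) Y \<le> 1 * ?f * q powr (1 - h)"
    proof (rule ccontr)
      assume "\<not> ?thesis"
      then have "1 * potential R p h X Y \<le> potential R p h (X - {v}) Y"
        using fin f q by (intro potential_less) auto
      with lt show False by simp
    qed
    also have "q powr (1 - h) \<le> (1 - h) * q + h * 1"
      using weighted_arith_geo_mean[of q 1 h] q h by simp
    also have "(1 - h) * q + h * 1 = 1 - (1 - h) / ?n"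
      using nN by (simp add: q_def field_simps)
    finally have "excess R p (X - {v}) Y \<le> ?f * (1 - (1 - h) / ?n)"
      using f by (simp add: mult_left_mono)
    moreover have "?f * (1 - (1 - h) / ?n) = ?f - (1 - h) * ?f / ?n"
      by (simp add: algebra_simps)
    ultimately show ?thesis
      using f_eq by linarith
  qed
qed

text \<open>Summing the lower bound on single vertices over \<open>T\<close> shows that the excess
  density shrinks at most by the factor 1 - h; the loss in size costs only c^h.\<close>

lemma book_potential_ge:
  fixes c h :: real
  assumes fin: "finite X" "finite Y" and T: "T \<subseteq> X" and h: "0 < h" "h < 1" and c: "0 < c"
    and f: "0 < excess R p X Y"
    and deg: "\<And>v. v \<in> X \<Longrightarrow> (1 - h) * excess R p X Y / card X \<le> excess R p {v} Y"
    and cT: "c * card X \<le> real (card T)"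
  shows "(1 - h) * c powr h * potential R p h X Y \<le> potential R p h T Y"
proof -
  let ?f = "excess R p X Y" and ?n = "real (card X)" and ?N = "real (card Y)"
  have nN: "0 < card X" "0 < card Y"
    using f fin by (auto simp: excess_def card_gt_0_iff)
  have t: "0 < card T"
  proof -
    have "0 < c * card X" using c nN by simp
    with cT show ?thesis by linarith
  qed
  have "real (card T) * ((1 - h) * ?f / ?n) = (\<Sum>v\<in>T. (1 - h) * ?f / ?n)" by simp
  also have "\<dots> \<le> (\<Sum>v\<in>T. excess R p {v} Y)"
    using deg T by (intro sum_mono) auto
  also have "\<dots> = excess R p T Y" by (simp add: excess_def)
  finally have "(1 - h) * (?f / ?n) \<le> excess R p T Y / card T"
    using t by (simp add: field_simps)
  then have e: "(1 - h) * (?f / (?n * ?N)) \<le> excess R p T Y / (real (card T) * ?N)"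
    using nN by (simp add: field_simps)
  have "c powr h * (?n * ?N) powr h = (c * ?n * ?N) powr h"
    using c by (simp add: powr_mult mult.assoc)
  also have "\<dots> \<le> (real (card T) * ?N) powr h"
    using cT c h by (intro powr_mono2 mult_right_mono) auto
  finally have "c powr h * (?n * ?N) powr h \<le> (real (card T) * ?N) powr h" .
  with e have "((1 - h) * (?f / (?n * ?N))) * (c powr h * (?n * ?N) powr h)
      \<le> excess R p T Y / (real (card T) * ?N) * (real (card T) * ?N) powr h"
    using h f by (intro mult_mono) (auto intro: order_trans[rotated])
  then show ?thesis
    using nN t by (simp add: potential_eq mult_ac)
qed

lemma red_step:
  assumes "graph R" "v \<in> X"
    and "has_clique R (nbs R v X \<union> nbs R v Y) k \<or> has_clique (co R) (nbs R v X) l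
      \<or> has_clique (co R) (nbs R v Y) L"
  shows "has_clique R (X \<union> Y) (Suc k) \<or> has_clique (co R) X l \<or> has_clique (co R) Y L"
proof -
  have "has_clique R (X \<union> Y) (Suc k)" if "has_clique R (nbs R v X \<union> nbs R v Y) k"
    using assms that by (intro has_clique_nbs[of R _ k v "X \<union> Y"]) (auto simp: nbs_def)
  then show ?thesis
    using assms(3) has_clique_mono[OF _ nbs_subset] by metis
qed

text \<open>\<open>v\<close> is blue to the new part of \<open>X\<close> and extends the blue
  cliques found there; cliques in the other places are merely kept.\<close>

lemma boost_step:
  assumes "graph R" "v \<in> X"
    and "has_clique R (nbs (co R) v X \<union> nbs R v Y) k \<or> has_clique (co R) (nbs (co R) v X) l
      \<or> has_clique (co R) (nbs R v Y) L"
  shows "has_clique R (X \<union> Y) k \<or> has_clique (co R) X (Suc l) \<or> has_clique (co R) Y L"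
proof -
  have "has_clique (co R) X (Suc l)" if "has_clique (co R) (nbs (co R) v X) l"
    using assms that by (intro has_clique_nbs[of "co R" _ l v X]) (auto simp: nbs_def graph_co)
  moreover have "nbs (co R) v X \<union> nbs R v Y \<subseteq> X \<union> Y" by (auto simp: nbs_def)
  ultimately show ?thesis
    using assms(3) has_clique_mono[OF _ nbs_subset] has_clique_mono by metis
qed

lemma power_powr_swap: "0 \<le> a \<Longrightarrow> (a ^ k) powr h = (a powr h) ^ k" for a :: real
  by (induction k) (simp_all add: powr_mult)

text \<open>Hypothesis \<open>C\<close> says that \<open>Y\<close> is too small for the known Ramsey
  bound. Inserted into the potential, it leaves a surplus ((x'/x)^h)^k that the excess per vertex of
  \<open>Y\<close> must account for. As x < x' in the application, this excess grows exponentially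
  in k.\<close>

lemma excess_lower_bound:
  fixes x x' y M h C D p :: real
  assumes nN: "0 < card X" "0 < card Y" and f: "0 < excess R p X Y"
    and x: "0 < x" "0 < x'" and y: "0 < y" and M: "0 < M" "M \<le> 1" and h: "0 < h" "h < 1"
    and D: "D \<le> potential R p h X Y * (x powr h) ^ k * (M powr h) ^ l * (y powr h) ^ L"
    and C: "real (card Y) * x' ^ k * y ^ L \<le> C"
  shows "D * ((x' / x) powr h) ^ k \<le> C powr h * (excess R p X Y / card Y)"
proof -
  let ?n = "real (card X)" and ?N = "real (card Y)"
  define e where "e = excess R p X Y / (?n * ?N)"
  have e: "0 < e" using nN f by (simp add: e_def)
  have n1: "?n powr h \<le> ?n"
    using powr_mono[of h 1 ?n] nN h by simp
  have NC: "?N powr h * (x' powr h) ^ k * (y powr h) ^ L \<le> C powr h"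
  proof -
    have "?N powr h * (x' powr h) ^ k * (y powr h) ^ L = (?N * x' ^ k * y ^ L) powr h"
      using x y by (simp add: powr_mult power_powr_swap)
    also have "\<dots> \<le> C powr h"
      using C x y h by (intro powr_mono2) auto
    finally show ?thesis .
  qed
  have "D * ((x' / x) powr h) ^ k
      \<le> potential R p h X Y * (x powr h) ^ k * (M powr h) ^ l * (y powr h) ^ L * ((x' / x) powr h) ^ k"
    using D by (intro mult_right_mono) auto
  also have "\<dots> = e * ?n powr h * (M powr h) ^ l
      * (?N powr h * ((x powr h) ^ k * ((x' / x) powr h) ^ k) * (y powr h) ^ L)"
    using nN by (simp add: potential_eq e_def powr_mult)
  also have "(x powr h) ^ k * ((x' / x) powr h) ^ k = (x' powr h) ^ k"
    using x by (simp add: powr_mult flip: power_mult_distrib) (simp flip: powr_mult)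
  also have "e * ?n powr h * (M powr h) ^ l * (?N powr h * (x' powr h) ^ k * (y powr h) ^ L)
      \<le> e * ?n * 1 * C powr h"
    using e n1 M h NC
    by (intro mult_mono power_le_one) (auto simp: powr_le1)
  also have "\<dots> = C powr h * (excess R p X Y / ?N)"
    using nN by (simp add: e_def)
  finally show ?thesis .
qed

text \<open>Induction on |X|, where l counts the vertices still missing from the blue clique being built
  inside X, whereas a blue clique found inside Y has to reach the full size L on its own. If no
  vertex can be dropped from X without lowering the potential, then every vertex of X has almost
  average density to Y, so that passing to the pages of a blue book costs only the factor
  \<open>1 - h\<close>. The size b of the books is chosen such that \<open>M < M1\<close> pays for that factor.\<close>

lemma potential_forces_clique:
  fixes x x' y M M1 p h \<kappa> :: real
  assumes known: "ramsey_bound x' y" and x: "0 < x" "x < x'" and y: "0 < y"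
    and M: "0 < M" "M < M1" "x \<le> 1 - M1" and p: "0 < p" and h: "0 < h" "h < 1"
    and gap: "0 < \<kappa>" "(1 - M1) powr (1 - h) * x powr h + M1 \<le> (1 - \<kappa>) * p powr h"
  shows "\<exists>D>0. \<forall>(R :: nat \<Rightarrow> nat \<Rightarrow> bool) X Y k l L. graph R \<longrightarrow> finite X \<longrightarrow> finite Y \<longrightarrow>
    D \<le> potential R p h X Y * (x powr h) ^ k * (M powr h) ^ l * (y powr h) ^ L \<longrightarrow>
    has_clique R (X \<union> Y) k \<or> has_clique (co R) X l \<or> has_clique (co R) Y L"
proof -
  obtain C where C: "\<And>(R :: nat \<Rightarrow> nat \<Rightarrow> bool) V k l. graph R \<Longrightarrow> finite V \<Longrightarrow>
     C \<le> real (card V) * x' ^ k * y ^ l \<Longrightarrow> has_clique R V k \<or> has_clique (co R) V l"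
    using known unfolding ramsey_bound_def by blast
  define C0 where "C0 = max C 1"
  have C0: "0 < C0" by (simp add: C0_def)
  \<comment> \<open>The gap between \<open>M\<close> and \<open>M1\<close> pays for two losses of a
    book: over b vertices, \<open>M2\<close> against \<open>M\<close> covers the factor 1 - h; then
    m is taken so large that the density M1 - b/m of the pages stays above
    \<open>M2\<close>.\<close>
  define M2 where "M2 = (M + M1) / 2"
  have M2: "M < M2" "M2 < M1" "0 < M2" using M by (auto simp: M2_def)
  have "(M / M2) powr h < 1"
    using powr_less_mono2[of h "M / M2" 1] M M2 h by simp
  then obtain b where b: "((M / M2) powr h) ^ b < 1 - h"
    using h real_arch_pow_inv[of "1 - h" "(M / M2) powr h"] by auto
  have b0: "0 < b" using b h by (intro gr0I) auto
  obtain m :: nat where m: "real b / (M1 - M2) < real m"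
    using reals_Archimedean2 by blast
  have "0 < real b / (M1 - M2)" using b0 M2 by simp
  then have m0: "0 < real m" using m by linarith
  have bm: "real b < (M1 - M2) * m"
    using m M2 by (simp add: field_simps)
  also have "\<dots> < M1 * m"
    using M2 m0 by (intro mult_strict_right_mono) auto
  finally have bM1: "real b < M1 * m" .
  have M2_le: "M2 \<le> M1 - b / m"
    using bm m0 by (simp add: field_simps)
  define \<rho> where "\<rho> = (x' / x) powr h"
  have \<rho>: "1 < \<rho>"
    unfolding \<rho>_def using x h by (intro gr_one_powr) auto
  \<comment> \<open>With s = 1/\<rho>, the size of \<open>W\<close> that forces a red k-clique or a
    blue m-clique grows like \<rho>^k, the rate at which the excess per vertex of \<open>Y\<close>
    grows. As m is fixed, t^m is a constant.\<close>
  define s where "s = 1 / \<rho>"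
  define t where "t = 1 - s"
  have st: "0 < s" "0 < t" "s + t \<le> 1" using \<rho> by (auto simp: s_def t_def)
  \<comment> \<open>Chosen to give \<open>large\<close> below, so that a set \<open>W\<close> under
    the Erdos-Szekeres threshold is small enough for \<open>exists_good_vertex\<close>.\<close>
  define D where "D = C0 powr h * (1 + 2 / t ^ m) / (\<kappa> * p)"
  have D: "0 < D"
    using C0 st gap p by (auto simp: D_def intro!: mult_pos_pos divide_pos_pos add_pos_pos)
  show ?thesis
  proof (intro exI[of _ D] conjI D allI impI)
    fix R :: "nat \<Rightarrow> nat \<Rightarrow> bool" and X Y :: "nat set" and k l L
    assume R: "graph R" and fin: "finite X" "finite Y"
      and "D \<le> potential R p h X Y * (x powr h) ^ k * (M powr h) ^ l * (y powr h) ^ L"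
    then show "has_clique R (X \<union> Y) k \<or> has_clique (co R) X l \<or> has_clique (co R) Y L"
    proof (induction "card X" arbitrary: X Y k l rule: less_induct)
      case less
      note pot = less.prems(4)
      let ?f = "excess R p X Y" and ?n = "real (card X)" and ?N = "real (card Y)"
      let ?goal = "has_clique R (X \<union> Y) k \<or> has_clique (co R) X l \<or> has_clique (co R) Y L"
      \<comment> \<open>A move that keeps a fraction c of the potential is affordable if the lowered
        exponents win back 1/c. The power of y is the same before and after, since L stays
        fixed.\<close>
      have IH: "has_clique R (X' \<union> Y') k' \<or> has_clique (co R) X' l' \<or> has_clique (co R) Y' L"
        if sub: "finite X'" "finite Y'" "card X' < card X"
          and c: "c * potential R p h X Y \<le> potential R p h X' Y'"
          and exps: "(x powr h) ^ k * (M powr h) ^ l \<le> c * ((x powr h) ^ k' * (M powr h) ^ l')"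
        for X' Y' k' l' c
      proof (rule less.hyps[OF sub(3) R sub(1,2)])
        have pot0: "0 \<le> potential R p h X Y"
        proof (rule ccontr)
          assume "\<not> ?thesis"
          then have "potential R p h X Y * ((x powr h) ^ k * (M powr h) ^ l * (y powr h) ^ L) \<le> 0"
            by (intro mult_nonpos_nonneg) auto
          then show False using pot D by (simp add: mult.assoc)
        qed
        note pot
        also have "potential R p h X Y * (x powr h) ^ k * (M powr h) ^ l * (y powr h) ^ L
            = potential R p h X Y * ((x powr h) ^ k * (M powr h) ^ l) * (y powr h) ^ L"
          by (simp add: mult.assoc)
        also have "\<dots> \<le> potential R p h X Y * (c * ((x powr h) ^ k' * (M powr h) ^ l')) * (y powr h) ^ L"
          using exps pot0 by (intro mult_right_mono mult_left_mono) auto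
        also have "\<dots> = (c * potential R p h X Y) * ((x powr h) ^ k' * (M powr h) ^ l' * (y powr h) ^ L)"
          by (simp add: mult_ac)
        also have "\<dots> \<le> potential R p h X' Y' * ((x powr h) ^ k' * (M powr h) ^ l' * (y powr h) ^ L)"
          using c by (intro mult_right_mono) auto
        finally show "D \<le> potential R p h X' Y' * (x powr h) ^ k' * (M powr h) ^ l' * (y powr h) ^ L"
          by (simp add: mult.assoc)
      qed
      have f: "0 < ?f"
      proof (rule ccontr)
        assume "\<not> ?thesis"
        then have "?f * ((?n * ?N) powr (h - 1) * (x powr h) ^ k * (M powr h) ^ l * (y powr h) ^ L) \<le> 0"
          by (intro mult_nonpos_nonneg) auto
        then show False
          using pot D by (simp add: potential_def mult.assoc)
      qed
      then have nN: "0 < card X" "0 < card Y"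
        using less.prems by (auto simp: excess_def card_gt_0_iff)
      show ?case
      proof (cases "C0 \<le> ?N * x' ^ k * y ^ L")
        case True
        then have "has_clique R Y k \<or> has_clique (co R) Y L"
          using less.prems by (intro C) (auto simp: C0_def)
        then show ?thesis using has_clique_mono[of R Y k "X \<union> Y"] by auto
      next
        case smallY: False
        have "D * \<rho> ^ k \<le> C0 powr h * (?f / ?N)"
          unfolding \<rho>_def using nN f x y M h pot smallY by (intro excess_lower_bound) auto
        then have "C0 powr h * ((1 + 2 / t ^ m) * \<rho> ^ k) \<le> C0 powr h * (\<kappa> * p * (?f / ?N))"
          using gap p by (simp add: D_def field_simps)
        then have large: "(1 + 2 / t ^ m) * \<rho> ^ k \<le> \<kappa> * p * (?f / ?N)"
          using C0 by (subst (asm) mult_le_cancel_left_pos) auto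
        show ?thesis
        proof (cases "\<exists>v\<in>X. potential R p h X Y \<le> potential R p h (X - {v}) Y")
          case True
          then obtain v where v: "v \<in> X" "potential R p h X Y \<le> potential R p h (X - {v}) Y"
            by blast
          have "has_clique R (X - {v} \<union> Y) k \<or> has_clique (co R) (X - {v}) l \<or> has_clique (co R) Y L"
            using less.prems v nN by (intro IH[of _ _ 1]) auto
          moreover have "X - {v} \<union> Y \<subseteq> X \<union> Y" "X - {v} \<subseteq> X" by auto
          ultimately show ?thesis using has_clique_mono by metis
        next
          case False
          have deg: "(1 - h) * ?f / ?n \<le> excess R p {v} Y" if "v \<in> X" for v
            using False that less.prems f h by (intro excess_vertex_ge) (auto simp: not_le)
          define W where "W = {v \<in> X. M1 * ?n < real (card (nbs (co R) v X))}"
          have W: "W \<subseteq> X" "finite W" using less.prems by (auto simp: W_def)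
          show ?thesis
          proof (cases "2 \<le> (real (card W) + 1) * s ^ k * t ^ m")
            case True
            have "has_clique R W k \<or> has_clique (co R) W m"
              by (rule erdos_szekeres[OF R W(2) st True])
            then show ?thesis
            proof
              assume "has_clique R W k"
              then show ?thesis using W has_clique_mono[of R W k "X \<union> Y"] by auto
            next
              assume "has_clique (co R) W m"
              then obtain U where U: "U \<subseteq> W" "finite U" "card U = m"
                "\<forall>u\<in>U. \<forall>v\<in>U. u \<noteq> v \<longrightarrow> co R u v"
                unfolding has_clique_def by blast
              obtain S where S: "S \<subseteq> U" "card S = b"
                "(M1 - b / card U) ^ b * card X \<le> real (card {v \<in> X. \<forall>s\<in>S. co R s v})"
              proof (rule exists_book[OF graph_co[OF R] less.prems(2), of U M1 b])
                show "U \<subseteq> X" using U W by blast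
                show "0 < M1" using M by simp
                show "real b < M1 * real (card U)" using bM1 U by simp
                show "M1 * ?n \<le> real (card (nbs (co R) u X))" if "u \<in> U" for u
                  using U that by (auto simp: W_def)
              qed auto
              have SX: "S \<subseteq> X" "finite S"
                using S U W finite_subset by blast+
              have Sclique: "has_clique (co R) S b"
                unfolding has_clique_def using S U SX by (intro exI[of _ S]) blast
              show ?thesis
              proof (cases "l \<le> b")
                case True
                then show ?thesis
                  using has_clique_le[OF Sclique] has_clique_mono SX by metis
              next
                case False
                define T where "T = {v \<in> X. \<forall>s\<in>S. co R s v}"
                \<comment> \<open>As b > 0, the spine has a vertex, which is not its own blue
                  neighbour. The pages thus form a proper subset of \<open>X\<close>, as the
                  induction requires.\<close>
                obtain s0 where s0: "s0 \<in> S" using S b0 by fastforce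
                have T: "T \<subseteq> X" "finite T" using less.prems by (auto simp: T_def)
                have "s0 \<notin> T" using s0 by (auto simp: T_def co_def)
                then have "T \<subset> X" using T s0 SX by blast
                then have cT: "card T < card X" using less.prems by (simp add: psubset_card_mono)
                have "M2 ^ b * card X \<le> (M1 - b / card U) ^ b * card X"
                  using M2 M2_le U by (intro mult_right_mono power_mono) auto
                with S have T_ge: "M2 ^ b * card X \<le> real (card T)" by (simp add: T_def)
                have "has_clique R (T \<union> Y) k \<or> has_clique (co R) T (l - b) \<or> has_clique (co R) Y L"
                proof (rule IH)
                  show "(1 - h) * (M2 ^ b) powr h * potential R p h X Y \<le> potential R p h T Y"
                    using less.prems T h M2 f deg T_ge by (intro book_potential_ge[of X]) auto
                  have "(M powr h) ^ b = ((M / M2) powr h) ^ b * (M2 powr h) ^ b"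
                    using M M2 by (simp add: powr_mult flip: power_mult_distrib) (simp flip: powr_mult)
                  also have "\<dots> \<le> (1 - h) * (M2 powr h) ^ b"
                    using b by (intro mult_right_mono) auto
                  finally have "(M powr h) ^ b * ((x powr h) ^ k * (M powr h) ^ (l - b))
                      \<le> (1 - h) * (M2 powr h) ^ b * ((x powr h) ^ k * (M powr h) ^ (l - b))"
                    by (intro mult_right_mono) auto
                  moreover have "(M powr h) ^ b * ((x powr h) ^ k * (M powr h) ^ (l - b))
                      = (x powr h) ^ k * (M powr h) ^ l"
                    using False by (simp add: mult.left_commute flip: power_add)
                  moreover have "(M2 ^ b) powr h = (M2 powr h) ^ b"
                    using M2 by (simp add: power_powr_swap)
                  ultimately show "(x powr h) ^ k * (M powr h) ^ l
                      \<le> (1 - h) * (M2 ^ b) powr h * ((x powr h) ^ k * (M powr h) ^ (l - b))"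
                    by (simp only:)
                qed (use less.prems T cT in auto)
                then consider "has_clique R (T \<union> Y) k" | "has_clique (co R) T (l - b)"
                  | "has_clique (co R) Y L" by blast
                then show ?thesis
                proof cases
                  case 1
                  then show ?thesis
                    using T has_clique_mono[of R "T \<union> Y" k "X \<union> Y"] by auto
                next
                  case 2
                  have "has_clique (co R) (S \<union> T) (b + (l - b))"
                    using R Sclique 2 by (intro has_clique_union graph_co) (auto simp: T_def)
                  then show ?thesis
                    using False SX T has_clique_mono[of "co R" "S \<union> T" l X] by auto
                qed auto
              qed
            qed
          next
            case fewW: False
            show ?thesis
            proof (cases "k = 0 \<or> l = 0")
              case True
              then show ?thesis by auto
            next
              case False
              then obtain k' l' where kl: "k = Suc k'" "l = Suc l'"
                by (meson not0_implies_Suc)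
              have "(real (card W) + 1) * (s ^ k * t ^ m) < 2"
                using fewW by (simp add: mult.assoc)
              then have "(real (card W) + 1) < 2 / t ^ m * \<rho> ^ k"
                using st \<rho> by (simp add: s_def field_simps)
              also have "\<dots> < (1 + 2 / t ^ m) * \<rho> ^ k"
                using \<rho> by (simp add: distrib_right)
              also note large
              finally have few: "(1 + real (card W)) * ?N < \<kappa> * p * ?f"
                using nN by (simp add: field_simps)
              show ?thesis
              proof (rule exists_good_vertex[OF R less.prems(2,3) W(1) p _ x(1) M(3) h gap _ f few])
                show "0 < M1" using M by simp
              next
                fix v assume "v \<in> X - W"
                then show "real (card (nbs (co R) v X)) \<le> M1 * real (card X)"
                  by (auto simp: W_def)
              next
                fix v assume v: "v \<in> X" and
                  "x powr h * ?f * (real (card (nbs R v X)) * real (card (nbs R v Y)) / (?n * ?N)) powr (1 - h)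
                    < excess R p (nbs R v X) (nbs R v Y)"
                then have "x powr h * potential R p h X Y \<le> potential R p h (nbs R v X) (nbs R v Y)"
                  using less.prems f by (intro potential_less) auto
                then have "has_clique R (nbs R v X \<union> nbs R v Y) k' \<or> has_clique (co R) (nbs R v X) l
                    \<or> has_clique (co R) (nbs R v Y) L"
                  using less.prems v card_nbs_less[of X R v] kl by (intro IH[of _ _ "x powr h"]) auto
                then show ?thesis
                  using red_step[OF R v] kl by simp
              next
                fix v assume v: "v \<in> X" and
                  "M1 powr h * ?f * (real (card (nbs (co R) v X)) * real (card (nbs R v Y)) / (?n * ?N)) powr (1 - h)
                    < excess R p (nbs (co R) v X) (nbs R v Y)"
                then have "M1 powr h * potential R p h X Y \<le> potential R p h (nbs (co R) v X) (nbs R v Y)"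
                  using less.prems f by (intro potential_less) auto
                moreover have "(x powr h) ^ k * (M powr h) ^ l \<le> M1 powr h * ((x powr h) ^ k * (M powr h) ^ l')"
                proof -
                  have "M powr h * ((x powr h) ^ k * (M powr h) ^ l') \<le> M1 powr h * ((x powr h) ^ k * (M powr h) ^ l')"
                    using M h by (intro mult_right_mono powr_mono2) auto
                  then show ?thesis by (simp add: kl mult_ac)
                qed
                ultimately have "has_clique R (nbs (co R) v X \<union> nbs R v Y) k
                    \<or> has_clique (co R) (nbs (co R) v X) l' \<or> has_clique (co R) (nbs R v Y) L"
                  using less.prems v card_nbs_less[of X "co R" v] graph_co[OF R]
                  by (intro IH[of _ _ "M1 powr h"]) auto
                then show ?thesis
                  using boost_step[OF R v] kl by simp
              qed
            qed
          qed
        qed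
      qed
    qed
  qed
qed

section \<open>Improving exponential bounds\<close>

text \<open>For \<kappa> = 0 both sides of the final inequality equal 1 at h = 0. Choosing ln p
  midway between the two sides of \<open>less\<close> makes the left-hand side have the smaller
  derivative there, so strict inequality holds for some small h, and \<kappa> measures the
  slack.\<close>

lemma exists_gap:
  fixes x q M :: real
  assumes M: "0 < M" "M < 1" and x: "0 < x" and q: "0 < q"
    and less: "(1 - M) * ln (x / (1 - M)) < ln q"
  obtains p h \<kappa> where "0 < p" "p < q" "0 < h" "h < 1" "0 < \<kappa>"
    "(1 - M) powr (1 - h) * x powr h + M \<le> (1 - \<kappa>) * p powr h"
proof -
  define c where "c = (1 - M) * ln (x / (1 - M))"
  define p where "p = exp ((c + ln q) / 2)"
  have p: "0 < p" "p < q" "c < ln p"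
  proof -
    have "p < exp (ln q)"
      unfolding p_def using less by (subst exp_less_cancel_iff) (simp add: c_def)
    then show "p < q" using q by simp
    show "c < ln p" using less by (simp add: p_def c_def)
  qed (simp add: p_def)
  define \<phi> where "\<phi> h = (1 - M) * exp (h * ln (x / (1 - M))) + M - exp (h * ln p)" for h
  have "(\<phi> has_real_derivative c - ln p) (at 0)"
    unfolding \<phi>_def c_def by (auto intro!: derivative_eq_intros)
  then obtain d where d: "0 < d" "\<And>h. 0 < h \<Longrightarrow> h < d \<Longrightarrow> \<phi> (0 + h) < \<phi> 0"
    using DERIV_neg_dec_right[of \<phi> "c - ln p" 0] p by auto
  define h where "h = min (d / 2) (1 / 2)"
  have h: "0 < h" "h < 1" "h < d" using d(1) by (auto simp: h_def)
  have "\<phi> h < 0" using d(2)[of h] h by (simp add: \<phi>_def)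
  moreover have "(1 - M) powr (1 - h) * x powr h = (1 - M) * exp (h * ln (x / (1 - M)))"
    using M x by (simp add: powr_def ln_div exp_diff exp_add algebra_simps)
  ultimately have "(1 - M) powr (1 - h) * x powr h + M < p powr h"
    using p by (simp add: \<phi>_def powr_def)
  then show ?thesis
    using that[of p h "1 - ((1 - M) powr (1 - h) * x powr h + M) / p powr h"] p h by simp
qed

text \<open>Induction on l: the blue neighbourhoods in a counterexample have density less than y0, so its
  red density exceeds p, and the potential argument applies with \<open>X = Y = V\<close>. The pair (x0, y0) is a
  weighted geometric mean of the pair (a, b) and of the pair (sqrt x, sqrt (M y)) which that
  argument yields.\<close>

lemma ramsey_bound_step:
  fixes x x' y M \<mu> a b x0 y0 :: real
  assumes known: "ramsey_bound x' y" and base: "ramsey_bound a b"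
    and x: "0 < x" "x < x'" and y: "0 < y" and M: "0 < M" "M < \<mu>" "\<mu> < 1"
    and ab: "0 < a" "0 < b" and xy0: "0 < x0" "x0 \<le> 1" "0 < y0" "y0 < 1"
    and less: "(1 - \<mu>) * ln (x / (1 - \<mu>)) < ln (1 - y0)"
    and ij: "0 < i + j"
    and x0: "x0 ^ (2 * (i + j)) \<le> x ^ i * a ^ (2 * j)"
    and y0: "y0 ^ (2 * (i + j)) \<le> (M * y) ^ i * b ^ (2 * j)"
  shows "ramsey_bound x0 y0"
proof -
  have "ln (1 - y0) < 0" using xy0 by simp
  with less have "(1 - \<mu>) * ln (x / (1 - \<mu>)) < 0" by linarith
  then have "ln (x / (1 - \<mu>)) < 0" using M by (simp add: mult_less_0_iff)
  then have xM: "x \<le> 1 - \<mu>" using x M by (simp add: ln_less_zero_iff)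
  obtain p h \<kappa> where p: "0 < p" "p < 1 - y0" and h: "0 < h" "h < 1" and \<kappa>: "0 < \<kappa>"
    "(1 - \<mu>) powr (1 - h) * x powr h + \<mu> \<le> (1 - \<kappa>) * p powr h"
    using exists_gap[OF _ M(3) x(1) _ less] M xy0 by auto
  obtain D where D: "0 < D" "\<And>(R :: nat \<Rightarrow> nat \<Rightarrow> bool) X Y k l L. graph R \<Longrightarrow> finite X \<Longrightarrow> finite Y \<Longrightarrow>
    D \<le> potential R p h X Y * (x powr h) ^ k * (M powr h) ^ l * (y powr h) ^ L \<Longrightarrow>
    has_clique R (X \<union> Y) k \<or> has_clique (co R) X l \<or> has_clique (co R) Y L"
    using potential_forces_clique[OF known x y M(1,2) xM p(1) h \<kappa>] by metis
  obtain B where B: "\<And>(R :: nat \<Rightarrow> nat \<Rightarrow> bool) V k l. graph R \<Longrightarrow> finite V \<Longrightarrow>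
     B \<le> real (card V) * a ^ k * b ^ l \<Longrightarrow> has_clique R V k \<or> has_clique (co R) V l"
    using base unfolding ramsey_bound_def by blast
  \<comment> \<open>In a counterexample red degrees exceed p |V| by at least 2 \<eta> |V| - 1. Half
    of this is given up to absorb the 1, which stands for the vertex itself.\<close>
  define \<eta> where "\<eta> = (1 - y0 - p) / 2"
  have \<eta>: "0 < \<eta>" using p by (simp add: \<eta>_def)
  define D2 where "D2 = (D / \<eta>) powr (1 / h)"
  define C where "C = Max {1, D2, B, 1 / \<eta>}"
  have C: "1 \<le> C" "D2 \<le> C" "B \<le> C" "1 / \<eta> \<le> C" by (simp_all add: C_def)
  \<comment> \<open>Without cliques, \<open>u\<close> and \<open>w\<close> below are at most
    \<open>C\<close>; the constant \<open>C + 1\<close> makes the resulting contradiction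
    strict.\<close>
  show ?thesis unfolding ramsey_bound_def
  proof (intro exI[of _ "C + 1"] allI impI)
    fix R :: "nat \<Rightarrow> nat \<Rightarrow> bool" and V :: "nat set" and k l
    assume R: "graph R" and "finite V" "C + 1 \<le> real (card V) * x0 ^ k * y0 ^ l"
    then show "has_clique R V k \<or> has_clique (co R) V l"
    proof (induction l arbitrary: V)
      case (Suc l)
      let ?n = "real (card V)"
      show ?case
      proof (rule ccontr)
        assume neg: "\<not> ?case"
        have le1: "x0 ^ k * y0 ^ Suc l \<le> 1"
          using xy0 by (intro mult_le_one power_le_one) auto
        have "C + 1 \<le> ?n * (x0 ^ k * y0 ^ Suc l)"
          using Suc.prems by (simp add: mult.assoc)
        also have "\<dots> \<le> ?n * 1"
          using le1 by (intro mult_left_mono) auto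
        finally have n: "C + 1 \<le> ?n" by simp
        have blue: "real (card (nbs (co R) v V)) \<le> y0 * ?n" if v: "v \<in> V" for v
        proof (rule ccontr)
          assume "\<not> ?thesis"
          then have "y0 * ?n * (x0 ^ k * y0 ^ l) \<le> card (nbs (co R) v V) * (x0 ^ k * y0 ^ l)"
            using xy0 by (intro mult_right_mono) auto
          then have "C + 1 \<le> real (card (nbs (co R) v V)) * x0 ^ k * y0 ^ l"
            using Suc.prems by (simp add: mult_ac)
          then have "has_clique R (nbs (co R) v V) k \<or> has_clique (co R) (nbs (co R) v V) l"
            using Suc.prems by (intro Suc.IH) auto
          then show False
            using neg has_clique_mono[OF _ nbs_subset]
              has_clique_nbs[OF graph_co[OF R] _ order_refl v nbs_subset] by metis
        qed
        have red: "?n * \<eta> \<le> real (card (nbs R v V)) - p * ?n" if v: "v \<in> V" for v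
        proof -
          have "V = insert v (nbs R v V \<union> nbs (co R) v V)"
            using v by (auto simp: nbs_def co_def)
          then have "card V = card (insert v (nbs R v V \<union> nbs (co R) v V))" by simp
          also have "\<dots> \<le> Suc (card (nbs R v V \<union> nbs (co R) v V))"
            by (rule card_insert_le_m1) auto
          also have "card (nbs R v V \<union> nbs (co R) v V) \<le> card (nbs R v V) + card (nbs (co R) v V)"
            by (rule card_Un_le)
          finally have "?n \<le> 1 + real (card (nbs R v V)) + real (card (nbs (co R) v V))" by simp
          moreover have "1 \<le> C * \<eta>" "C * \<eta> \<le> ?n * \<eta>"
            using n C \<eta> by (auto simp: field_simps)
          ultimately show ?thesis
            using blue[OF v] by (simp add: \<eta>_def field_simps)
        qed
        have "?n * (?n * \<eta>) = (\<Sum>v\<in>V. ?n * \<eta>)" by simp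
        also have "\<dots> \<le> excess R p V V"
          unfolding excess_degrees[OF Suc.prems(2)] by (intro sum_mono red)
        finally have "?n * (?n * \<eta>) * (?n * ?n) powr (h - 1) \<le> potential R p h V V"
          unfolding potential_def by (intro mult_right_mono) auto
        moreover have "?n * (?n * \<eta>) * (?n * ?n) powr (h - 1) = \<eta> * (?n * ?n) powr h"
          using n C by (simp add: powr_diff)
        ultimately have pot: "\<eta> * (?n * ?n) powr h \<le> potential R p h V V" by simp
        \<comment> \<open>\<open>u\<close> stems from the potential of the pair (V, V), hence the
          square of |V|, and \<open>w\<close> from the base bound. By \<open>x0\<close> and
          \<open>y0\<close>, the 2(i + j)-th power of |V| x0^k y0^(l + 1) is at most u^i
          w^(2j).\<close>
        define u where "u = ?n\<^sup>2 * x ^ k * (M * y) ^ Suc l"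
        define w where "w = ?n * a ^ k * b ^ Suc l"
        have u0: "0 \<le> u" and w0: "0 \<le> w"
          using x M y ab by (auto simp: u_def w_def)
        have "\<eta> * u powr h = \<eta> * (?n * ?n) powr h * (x powr h) ^ k * (M powr h) ^ Suc l * (y powr h) ^ Suc l"
          using x M y by (simp add: u_def powr_mult power_powr_swap power2_eq_square power_mult_distrib mult_ac)
        also have "\<dots> \<le> potential R p h V V * (x powr h) ^ k * (M powr h) ^ Suc l * (y powr h) ^ Suc l"
          using pot by (intro mult_right_mono) auto
        also have "\<dots> < D"
          using D(2)[OF R Suc.prems(2,2), of k "Suc l" "Suc l"] neg by (auto simp: not_le[symmetric])
        finally have "u powr h \<le> D / \<eta>"
          using \<eta> by (simp add: field_simps)
        then have "(u powr h) powr (1 / h) \<le> D2"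
          unfolding D2_def using h by (intro powr_mono2) auto
        then have uC: "u \<le> C"
          using u0 h C by (simp add: powr_powr)
        have wC: "w \<le> C"
          using B[OF R Suc.prems(2), of k "Suc l"] neg C by (force simp: w_def)
        have "(C + 1) ^ (2 * (i + j)) \<le> (?n * x0 ^ k * y0 ^ Suc l) ^ (2 * (i + j))"
          using Suc.prems C by (intro power_mono) auto
        also have "\<dots> = ?n ^ (2 * (i + j)) * (x0 ^ (2 * (i + j))) ^ k * (y0 ^ (2 * (i + j))) ^ Suc l"
          by (simp only: power_mult_distrib flip: power_mult) (simp only: mult.commute)
        also have "\<dots> \<le> ?n ^ (2 * (i + j)) * (x ^ i * a ^ (2 * j)) ^ k * ((M * y) ^ i * b ^ (2 * j)) ^ Suc l"
          using x0 y0 xy0 x ab M y by (intro mult_mono power_mono) auto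
        also have "\<dots> = u ^ i * w ^ (2 * j)"
          unfolding u_def w_def
          by (simp only: power_mult_distrib distrib_left power_add flip: power_mult)
            (simp only: mult_ac)
        also have "\<dots> \<le> C ^ i * C ^ (2 * j)"
          using u0 w0 uC wC by (intro mult_mono power_mono) auto
        also have "\<dots> = C ^ (i + 2 * j)" by (simp add: power_add)
        also have "\<dots> \<le> C ^ (2 * (i + j))"
          using C by (intro power_increasing) auto
        also have "\<dots> < (C + 1) ^ (2 * (i + j))"
          using C ij by (intro power_strict_mono) auto
        finally show False by simp
      qed
    qed auto
  qed
qed

text \<open>Reduces the logarithmic condition of \<open>ramsey_bound_step\<close> to integer powers
  of rationals. The values 1/5 and 1/3 of \<mu> keep these powers small.\<close>

lemma ln_ratio_less:
  fixes x q :: real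
  assumes "0 < x" "0 < q" "x ^ m < q ^ n" "0 < n" "c = m / n"
  shows "c * ln x < ln q"
proof -
  have "ln (x ^ m) < ln (q ^ n)"
    using assms by simp
  then have "m * ln x < n * ln q"
    using assms by (simp add: ln_realpow)
  then have "m * ln x / n < ln q"
    using assms by (simp add: pos_divide_less_eq mult.commute)
  then show ?thesis
    by (simp add: assms(5))
qed

text \<open>The constants come from a numerical optimisation of the three successive improvements.\<close>

lemma ramsey_bound_first: "ramsey_bound (704 / 1000) (317 / 1000)"
proof (rule ramsey_bound_step[where x = "4963 / 10000" and x' = "4964 / 10000" and y = "5036 / 10000"
      and M = "1999 / 10000" and \<mu> = "1 / 5" and a = "1 / 2" and b = "1 / 2" and i = 1 and j = 0])
  show "(1 - 1 / 5) * ln (4963 / 10000 / (1 - 1 / 5)) < ln (1 - 317 / 1000 :: real)"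
    by (rule ln_ratio_less[where m = 4 and n = 5]) (simp_all add: power_divide)
qed (simp_all add: ramsey_bound_erdos_szekeres power_divide)

text \<open>The first bound enters twice: with the colours exchanged as the bound applied inside
  \<open>Y\<close>, and as it stands in the geometric mean.\<close>

lemma ramsey_bound_second: "ramsey_bound (629 / 1000) (3918 / 10000)"
proof (rule ramsey_bound_step[OF ramsey_bound_swap[OF ramsey_bound_first] ramsey_bound_first,
      where x = "316 / 1000" and M = "3333 / 10000" and \<mu> = "1 / 3" and i = 1 and j = 1])
  show "(1 - 1 / 3) * ln (316 / 1000 / (1 - 1 / 3)) < ln (1 - 3918 / 10000 :: real)"
    by (rule ln_ratio_less[where m = 2 and n = 3]) (simp_all add: power_divide)
qed (simp_all add: power_divide)

text \<open>The bound applied inside \<open>Y\<close> is itself a geometric mean, of the exchanged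
  first bound and an Erdos-Szekeres bound, tuned so that x' is just above x.\<close>

lemma ramsey_bound_diagonal: "ramsey_bound (5769 / 10000) (439 / 1000)"
proof (rule ramsey_bound_step[OF _ ramsey_bound_second,
      where x = "28 / 100" and x' = "2801 / 10000" and y = "7278 / 10000"
        and M = "3333 / 10000" and \<mu> = "1 / 3" and i = 1 and j = 1])
  have "ramsey_bound (2475 / 10000) (7525 / 10000)"
    by (rule ramsey_bound_erdos_szekeres) auto
  then show "ramsey_bound (2801 / 10000) (7278 / 10000)"
    by (rule ramsey_bound_geometric_mean[OF ramsey_bound_swap[OF ramsey_bound_first]])
      (simp_all add: power_divide)
  show "(1 - 1 / 3) * ln (28 / 100 / (1 - 1 / 3)) < ln (1 - 439 / 1000 :: real)"
    by (rule ln_ratio_less[where m = 2 and n = 3]) (simp_all add: power_divide)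
qed (simp_all add: power_divide)

section \<open>From graphs back to two-colourings and the diagonal Ramsey number\<close>

lemma partn_if_cliques:
  assumes "\<And>R :: nat \<Rightarrow> nat \<Rightarrow> bool. graph R \<Longrightarrow> has_clique R {..<N} k \<or> has_clique (co R) {..<N} k"
  shows "partn {..<N} k 2 {..<2 :: nat}"
  unfolding partn_def
proof
  fix f :: "nat set \<Rightarrow> nat" assume f: "f \<in> nsets {..<N} 2 \<rightarrow> {..<2}"
  \<comment> \<open>Colour 0 is red; on pairs inside {..<N}, \<open>co R\<close> is then colour
    1.\<close>
  define R where "R x y \<longleftrightarrow> x \<noteq> y \<and> f {x, y} = 0" for x y
  have "graph R"
    by (auto simp: graph_def symp_def irreflp_def R_def insert_commute)
  then obtain K c where K: "K \<subseteq> {..<N}" "finite K" "card K = k" "c < (2 :: nat)"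
    and mono: "\<forall>x\<in>K. \<forall>y\<in>K. x \<noteq> y \<longrightarrow> f {x, y} = c"
  proof -
    have "\<exists>c<2. has_clique (\<lambda>x y. f {x, y} = c) {..<N} k"
      using assms[OF \<open>graph R\<close>]
    proof
      assume "has_clique R {..<N} k"
      then show ?thesis by (intro exI[of _ 0]) (force simp: has_clique_def R_def)
    next
      assume "has_clique (co R) {..<N} k"
      then obtain K where K: "K \<subseteq> {..<N}" "finite K" "card K = k"
        "\<forall>x\<in>K. \<forall>y\<in>K. x \<noteq> y \<longrightarrow> co R x y"
        by (auto simp: has_clique_def)
      have "f {x, y} = 1" if "x \<in> K" "y \<in> K" "x \<noteq> y" for x y
      proof -
        have "{x, y} \<in> nsets {..<N} 2" using that K by auto
        then have "f {x, y} < 2" using f by auto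
        moreover have "f {x, y} \<noteq> 0" using K that by (auto simp: co_def R_def)
        ultimately show ?thesis by simp
      qed
      then show ?thesis using K by (intro exI[of _ 1]) (auto simp: has_clique_def)
    qed
    then show ?thesis using that by (auto simp: has_clique_def)
  qed
  have "f ` nsets K 2 \<subseteq> {c}"
    using mono by (auto elim!: nsets2_E)
  then show "\<exists>\<xi>\<in>{..<2}. monochromatic {..<N} k 2 f \<xi>"
    using K unfolding monochromatic_def
    by (intro bexI[of _ c] bexI[of _ K]) (auto simp: nsets_def)
qed

theorem theorem4p5:
  shows "\<exists>g :: nat \<Rightarrow> real. ((\<lambda>k. g k / real k) \<longlonglongrightarrow> 0) \<and>
    (\<forall>k::nat. k \<ge> 2 \<longrightarrow>
      real (ramsey_number k) \<le> 2 powr ((2 - 3 / 200) * real k + g k))"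
proof -
  define a :: real where "a = 5769 / 10000 * (439 / 1000)"
  have a: "0 < a" "a \<le> 1" by (simp_all add: a_def)
  obtain C where C: "\<And>(R :: nat \<Rightarrow> nat \<Rightarrow> bool) V k l. graph R \<Longrightarrow> finite V \<Longrightarrow>
     C \<le> real (card V) * (5769 / 10000) ^ k * (439 / 1000) ^ l \<Longrightarrow>
     has_clique R V k \<or> has_clique (co R) V l"
    using ramsey_bound_diagonal unfolding ramsey_bound_def by blast
  define D where "D = max C 1"
  have D: "1 \<le> D" "C \<le> D" by (simp_all add: D_def)
  \<comment> \<open>1/a is just below 79/20, whose binary logarithm is less than 127/64, and 127/64
    < 397/200 = 2 - 3/200. Only a 64th power has to be evaluated.\<close>
  have a_le: "1 / a \<le> 2 powr (397 / 200)"
  proof -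
    have "(79 / 20 :: real) ^ 64 \<le> 2 ^ 127"
      by (simp add: power_divide)
    also have "\<dots> = (2 powr (127 / 64)) ^ 64"
      by (simp add: powr_power)
    finally have "(79 / 20 :: real) \<le> 2 powr (127 / 64)"
      by (subst (asm) power_mono_iff) auto
    also have "\<dots> \<le> 2 powr (397 / 200)"
      by (intro powr_mono) auto
    finally show ?thesis by (simp add: a_def)
  qed
  have "real (ramsey_number k) \<le> 2 powr ((2 - 3 / 200) * real k + log 2 (2 * D))" for k
  proof -
    \<comment> \<open>Rounding up adds at most 1 to a number that is at least 1; hence the factor 2
      in \<open>log 2 (2 * D)\<close>, the constant value taken for g.\<close>
    define N where "N = nat \<lceil>D * (1 / a) ^ k\<rceil>"
    have ak: "1 \<le> (1 / a) ^ k" using a by (intro one_le_power) simp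
    have "D * (1 / a) ^ k * a ^ k \<le> real N * a ^ k"
      using a unfolding N_def by (intro mult_right_mono real_nat_ceiling_ge) simp
    then have "C \<le> real N * a ^ k"
      using a D by (simp add: power_divide)
    then have "C \<le> real (card {..<N}) * (5769 / 10000) ^ k * (439 / 1000) ^ k"
      by (simp only: a_def power_mult_distrib card_lessThan mult.assoc)
    then have "partn {..<N} k 2 {..<2 :: nat}"
      by (intro partn_if_cliques C) auto
    then have "real (ramsey_number k) \<le> real N"
      by (simp add: partn_iff_ramsey_number_le)
    also have "\<dots> \<le> D * (1 / a) ^ k + 1"
      using D ak by (simp add: N_def)
    also have "\<dots> \<le> 2 * D * (1 / a) ^ k"
      using mult_mono[OF D(1) ak] D by simp
    also have "\<dots> \<le> 2 * D * (2 powr (397 / 200)) ^ k"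
      using a_le a D by (intro mult_left_mono power_mono) auto
    also have "\<dots> = 2 powr ((2 - 3 / 200) * real k + log 2 (2 * D))"
      using D by (simp add: powr_power powr_add mult.commute)
    finally show ?thesis .
  qed
  moreover have "(\<lambda>k. log 2 (2 * D) / real k) \<longlonglongrightarrow> 0"
    by (rule lim_const_over_n)
  ultimately show ?thesis
    by (intro exI[of _ "\<lambda>_. log 2 (2 * D)"]) auto
qed

end
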